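(* Every ICD-category is ICD-equivalent to a strict one. That is, for every ICD-category $\mathsf C$ there are an ICD-category $\mathsf C'$ whose underlying monoidal category is strict and an ICD-equivalence $\mathsf C'\to\mathsf C$.
   Context: **ICD-categories.** A hom-involutive symmetric monoidal category is a symmetric monoidal category $(\mathsf C,\odot,I)$ with a strict symmetric monoidal endofunctor $\phi\mapsto\overline\phi$ (the involution) that is the identity on objects and whose square is the identity functor. An ICD-category is such a $\mathsf C$ in which every object $A$ comes with morphisms $\mathrm{copy}_A\colon A\to A\odot A$ and $\mathrm{del}_A\colon A\to I$ such that (suppressing coherence isomorphisms): (1) $(\mathrm{copy}_A\odot\mathrm{id})\mathrm{copy}_A=(\mathrm{id}\odot\mathrm{copy}_A)\mathrm{copy}_A$ and $(\mathrm{del}_A\odot\mathrm{id})\mathrm{copy}_A=\mathrm{id}_A=(\mathrm{id}\odot\mathrm{del}_A)\mathrm{copy}_A$; (2) $\overline{\mathrm{copy}_A}=\mathrm{swap}_{A,A}\,\mathrm{copy}_A$ and $\overline{\mathrm{del}_A}=\mathrm{del}_A$; (3) $\mathrm{copy}_{A\odot B}=(\mathrm{id}_A\odot\mathrm{swap}_{A,B}\odot\mathrm{id}_B)(\mathrm{copy}_A\odot\mathrm{copy}_B)$, $\mathrm{del}_{A\odot B}=\mathrm{del}_A\odot\mathrm{del}_B$, $\mathrm{del}_I=\mathrm{id}_I$, $\mathrm{copy}_I=\mathrm{id}_I$ (up to $I\cong I\odot I$). A morphism $\phi\colon A\to B$ is self-adjoint if $\overline\phi=\phi$, total if $\mathrm{del}_B\,\phi=\mathrm{del}_A$,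 and deterministic if it is self-adjoint, total and $\mathrm{copy}_B\,\phi=(\phi\odot\phi)\,\mathrm{copy}_A$. **ICD-functors.** A strong ICD-functor $F\colon\mathsf C\to\mathsf D$ between ICD-categories is a strong symmetric monoidal functor such that $F(\overline\phi)=\overline{F(\phi)}$ for every morphism, its coherence isomorphisms $\varphi_{A,B}\colon FA\odot FB\to F(A\odot B)$ and $\varphi_I\colon I\to F(I)$ are self-adjoint, and $\varphi_{A,A}\,\mathrm{copy}_{FA}=F(\mathrm{copy}_A)$, $\varphi_I\,\mathrm{del}_{FA}=F(\mathrm{del}_A)$ for all $A$. An ICD-natural transformation is a monoidal natural transformation between strong ICD-functors with deterministic components; an ICD-natural isomorphism is an invertible one. An ICD-equivalence is a strong ICD-functor $F\colon\mathsf C\to\mathsf D$ for which there exist a strong ICD-functor $G\colon\mathsf D\to\mathsf C$ and ICD-natural isomorphisms $FG\to\mathrm{id}_{\mathsf D}$ and $GF\to\mathrm{id}_{\mathsf C}$. *)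

theory Defs
  imports Main
begin

(* Composition is written in the usual order: g \<cdot> f is "g after f".  All data are given by
   total functions on the ambient types; only their values on Obj and Arr matter.
   The monoidal product is written \<odot> on objects and \<otimes> on morphisms. *)

record ('o, 'a) category =
  Obj :: "'o set"
  Arr :: "'a set"
  Dom :: "'a \<Rightarrow> 'o"
  Cod :: "'a \<Rightarrow> 'o"
  Ident :: "'o \<Rightarrow> 'a"  ("id\<index>")
  Comp :: "'a \<Rightarrow> 'a \<Rightarrow> 'a"  (infixr "\<cdot>\<index>" 55)

definition Hom :: "('o, 'a, 'z) category_scheme \<Rightarrow> 'o \<Rightarrow> 'o \<Rightarrow> 'a set" where
  "Hom C A B = {f \<in> Arr C. Dom C f = A \<and> Cod C f = B}"

definition inverse_arrows :: "('o, 'a, 'z) category_scheme \<Rightarrow> 'a \<Rightarrow> 'a \<Rightarrow> bool" where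
  "inverse_arrows C f g \<longleftrightarrow>
     f \<in> Arr C \<and> g \<in> Hom C (Cod C f) (Dom C f) \<and>
     g \<cdot>\<^bsub>C\<^esub> f = id\<^bsub>C\<^esub> (Dom C f) \<and> f \<cdot>\<^bsub>C\<^esub> g = id\<^bsub>C\<^esub> (Cod C f)"

definition is_iso :: "('o, 'a, 'z) category_scheme \<Rightarrow> 'a \<Rightarrow> bool" where
  "is_iso C f \<longleftrightarrow> (\<exists>g. inverse_arrows C f g)"

definition inverse_of :: "('o, 'a, 'z) category_scheme \<Rightarrow> 'a \<Rightarrow> 'a" where
  "inverse_of C f = (THE g. inverse_arrows C f g)"

locale category =
  fixes C :: "('o, 'a, 'z) category_scheme" (structure)
  assumes dom_obj: "f \<in> Arr C \<Longrightarrow> Dom C f \<in> Obj C"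
    and cod_obj: "f \<in> Arr C \<Longrightarrow> Cod C f \<in> Obj C"
    and ident_hom: "A \<in> Obj C \<Longrightarrow> id A \<in> Hom C A A"
    and comp_hom: "\<lbrakk>f \<in> Hom C X Y; g \<in> Hom C Y Z\<rbrakk> \<Longrightarrow> g \<cdot> f \<in> Hom C X Z"
    and comp_ident_left: "f \<in> Hom C X Y \<Longrightarrow> id Y \<cdot> f = f"
    and comp_ident_right: "f \<in> Hom C X Y \<Longrightarrow> f \<cdot> id X = f"
    and comp_assoc: "\<lbrakk>f \<in> Hom C W X; g \<in> Hom C X Y; h \<in> Hom C Y Z\<rbrakk> \<Longrightarrow> (h \<cdot> g) \<cdot> f = h \<cdot> (g \<cdot> f)"

(* \<a> A B C : (A \<odot> B) \<odot> C \<rightarrow> A \<odot> (B \<odot> C),  \<l> A : I \<odot> A \<rightarrow> A,  \<r> A : A \<odot> I \<rightarrow> A *)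
record ('o, 'a) monoidal_category = "('o, 'a) category" +
  Tensor_obj :: "'o \<Rightarrow> 'o \<Rightarrow> 'o"  (infixr "\<odot>\<index>" 70)
  Tensor_arr :: "'a \<Rightarrow> 'a \<Rightarrow> 'a"  (infixr "\<otimes>\<index>" 70)
  Unit_obj :: "'o"  ("\<I>\<index>")
  Assoc :: "'o \<Rightarrow> 'o \<Rightarrow> 'o \<Rightarrow> 'a"  ("\<a>\<index>")
  Left_unitor :: "'o \<Rightarrow> 'a"  ("\<l>\<index>")
  Right_unitor :: "'o \<Rightarrow> 'a"  ("\<r>\<index>")

locale monoidal_category = category C
  for C :: "('o, 'a, 'z) monoidal_category_scheme" (structure) +
  assumes unit_obj: "\<I> \<in> Obj C"
    and tensor_obj: "\<lbrakk>A \<in> Obj C; B \<in> Obj C\<rbrakk> \<Longrightarrow> A \<odot> B \<in> Obj C"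
    and tensor_hom: "\<lbrakk>f \<in> Hom C X Y; g \<in> Hom C X' Y'\<rbrakk> \<Longrightarrow> f \<otimes> g \<in> Hom C (X \<odot> X') (Y \<odot> Y')"
    and tensor_ident: "\<lbrakk>A \<in> Obj C; B \<in> Obj C\<rbrakk> \<Longrightarrow> id A \<otimes> id B = id (A \<odot> B)"
    and tensor_comp: "\<lbrakk>f \<in> Hom C X Y; g \<in> Hom C Y Z; f' \<in> Hom C X' Y'; g' \<in> Hom C Y' Z'\<rbrakk> \<Longrightarrow>
          (g \<cdot> f) \<otimes> (g' \<cdot> f') = (g \<otimes> g') \<cdot> (f \<otimes> f')"
    and assoc_hom: "\<lbrakk>A \<in> Obj C; B \<in> Obj C; D \<in> Obj C\<rbrakk> \<Longrightarrow>
          \<a> A B D \<in> Hom C ((A \<odot> B) \<odot> D) (A \<odot> (B \<odot> D))"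
    and assoc_iso: "\<lbrakk>A \<in> Obj C; B \<in> Obj C; D \<in> Obj C\<rbrakk> \<Longrightarrow> is_iso C (\<a> A B D)"
    and assoc_natural: "\<lbrakk>f \<in> Hom C A A'; g \<in> Hom C B B'; h \<in> Hom C D D'\<rbrakk> \<Longrightarrow>
          \<a> A' B' D' \<cdot> ((f \<otimes> g) \<otimes> h) = (f \<otimes> (g \<otimes> h)) \<cdot> \<a> A B D"
    and left_unitor_hom: "A \<in> Obj C \<Longrightarrow> \<l> A \<in> Hom C (\<I> \<odot> A) A"
    and left_unitor_iso: "A \<in> Obj C \<Longrightarrow> is_iso C (\<l> A)"
    and left_unitor_natural: "f \<in> Hom C A B \<Longrightarrow> \<l> B \<cdot> (id \<I> \<otimes> f) = f \<cdot> \<l> A"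
    and right_unitor_hom: "A \<in> Obj C \<Longrightarrow> \<r> A \<in> Hom C (A \<odot> \<I>) A"
    and right_unitor_iso: "A \<in> Obj C \<Longrightarrow> is_iso C (\<r> A)"
    and right_unitor_natural: "f \<in> Hom C A B \<Longrightarrow> \<r> B \<cdot> (f \<otimes> id \<I>) = f \<cdot> \<r> A"
    and pentagon: "\<lbrakk>A \<in> Obj C; B \<in> Obj C; D \<in> Obj C; E \<in> Obj C\<rbrakk> \<Longrightarrow>
          (id A \<otimes> \<a> B D E) \<cdot> \<a> A (B \<odot> D) E \<cdot> (\<a> A B D \<otimes> id E) =
          \<a> A B (D \<odot> E) \<cdot> \<a> (A \<odot> B) D E"
    and triangle: "\<lbrakk>A \<in> Obj C; B \<in> Obj C\<rbrakk> \<Longrightarrow> (id A \<otimes> \<l> B) \<cdot> \<a> A \<I> B = \<r> A \<otimes> id B"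

locale strict_monoidal_category = monoidal_category C
  for C :: "('o, 'a, 'z) monoidal_category_scheme" (structure) +
  assumes strict_tensor_assoc: "\<lbrakk>A \<in> Obj C; B \<in> Obj C; D \<in> Obj C\<rbrakk> \<Longrightarrow> (A \<odot> B) \<odot> D = A \<odot> (B \<odot> D)"
    and strict_unit_left: "A \<in> Obj C \<Longrightarrow> \<I> \<odot> A = A"
    and strict_unit_right: "A \<in> Obj C \<Longrightarrow> A \<odot> \<I> = A"
    and strict_assoc: "\<lbrakk>A \<in> Obj C; B \<in> Obj C; D \<in> Obj C\<rbrakk> \<Longrightarrow> \<a> A B D = id (A \<odot> (B \<odot> D))"
    and strict_left_unitor: "A \<in> Obj C \<Longrightarrow> \<l> A = id A"
    and strict_right_unitor: "A \<in> Obj C \<Longrightarrow> \<r> A = id A"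

(* swap A B : A \<odot> B \<rightarrow> B \<odot> A *)
record ('o, 'a) symmetric_monoidal_category = "('o, 'a) monoidal_category" +
  Swap :: "'o \<Rightarrow> 'o \<Rightarrow> 'a"  ("swap\<index>")

locale symmetric_monoidal_category = monoidal_category C
  for C :: "('o, 'a, 'z) symmetric_monoidal_category_scheme" (structure) +
  assumes swap_hom: "\<lbrakk>A \<in> Obj C; B \<in> Obj C\<rbrakk> \<Longrightarrow> swap A B \<in> Hom C (A \<odot> B) (B \<odot> A)"
    and swap_natural: "\<lbrakk>f \<in> Hom C A A'; g \<in> Hom C B B'\<rbrakk> \<Longrightarrow>
          swap A' B' \<cdot> (f \<otimes> g) = (g \<otimes> f) \<cdot> swap A B"
    and swap_swap: "\<lbrakk>A \<in> Obj C; B \<in> Obj C\<rbrakk> \<Longrightarrow> swap B A \<cdot> swap A B = id (A \<odot> B)"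
    and hexagon: "\<lbrakk>A \<in> Obj C; B \<in> Obj C; D \<in> Obj C\<rbrakk> \<Longrightarrow>
          \<a> B D A \<cdot> swap A (B \<odot> D) \<cdot> \<a> A B D =
          (id B \<otimes> swap A D) \<cdot> \<a> B A D \<cdot> (swap A B \<otimes> id D)"

(* Conj is the action of the involution on morphisms. *)
record ('o, 'a) icd_category = "('o, 'a) symmetric_monoidal_category" +
  Conj :: "'a \<Rightarrow> 'a"  ("conj\<index>")
  Copy :: "'o \<Rightarrow> 'a"  ("copy\<index>")
  Del :: "'o \<Rightarrow> 'a"  ("del\<index>")

locale hom_involutive_symmetric_monoidal_category = symmetric_monoidal_category C
  for C :: "('o, 'a, 'z) icd_category_scheme" (structure) +
  assumes conj_hom: "f \<in> Hom C X Y \<Longrightarrow> conj f \<in> Hom C X Y"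
    and conj_ident: "A \<in> Obj C \<Longrightarrow> conj (id A) = id A"
    and conj_comp: "\<lbrakk>f \<in> Hom C X Y; g \<in> Hom C Y Z\<rbrakk> \<Longrightarrow> conj (g \<cdot> f) = conj g \<cdot> conj f"
    and conj_conj: "f \<in> Arr C \<Longrightarrow> conj (conj f) = f"
    and conj_tensor: "\<lbrakk>f \<in> Arr C; g \<in> Arr C\<rbrakk> \<Longrightarrow> conj (f \<otimes> g) = conj f \<otimes> conj g"
    and conj_assoc: "\<lbrakk>A \<in> Obj C; B \<in> Obj C; D \<in> Obj C\<rbrakk> \<Longrightarrow> conj (\<a> A B D) = \<a> A B D"
    and conj_left_unitor: "A \<in> Obj C \<Longrightarrow> conj (\<l> A) = \<l> A"
    and conj_right_unitor: "A \<in> Obj C \<Longrightarrow> conj (\<r> A) = \<r> A"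
    and conj_swap: "\<lbrakk>A \<in> Obj C; B \<in> Obj C\<rbrakk> \<Longrightarrow> conj (swap A B) = swap A B"

(* The morphism id_A \<otimes> swap_(A,B) \<otimes> id_B with its coherence isomorphisms restored:
   (A \<odot> A) \<odot> (B \<odot> B) \<rightarrow> A \<odot> (A \<odot> (B \<odot> B)) \<rightarrow> A \<odot> ((A \<odot> B) \<odot> B)
   \<rightarrow> A \<odot> ((B \<odot> A) \<odot> B) \<rightarrow> A \<odot> (B \<odot> (A \<odot> B)) \<rightarrow> (A \<odot> B) \<odot> (A \<odot> B) *)
definition middle_swap :: "('o, 'a, 'z) symmetric_monoidal_category_scheme \<Rightarrow> 'o \<Rightarrow> 'o \<Rightarrow> 'a" where
  "middle_swap C A B =
     inverse_of C (\<a>\<^bsub>C\<^esub> A B (A \<odot>\<^bsub>C\<^esub> B))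
     \<cdot>\<^bsub>C\<^esub> (id\<^bsub>C\<^esub> A \<otimes>\<^bsub>C\<^esub> \<a>\<^bsub>C\<^esub> B A B)
     \<cdot>\<^bsub>C\<^esub> (id\<^bsub>C\<^esub> A \<otimes>\<^bsub>C\<^esub> (swap\<^bsub>C\<^esub> A B \<otimes>\<^bsub>C\<^esub> id\<^bsub>C\<^esub> B))
     \<cdot>\<^bsub>C\<^esub> (id\<^bsub>C\<^esub> A \<otimes>\<^bsub>C\<^esub> inverse_of C (\<a>\<^bsub>C\<^esub> A B B))
     \<cdot>\<^bsub>C\<^esub> \<a>\<^bsub>C\<^esub> A A (B \<odot>\<^bsub>C\<^esub> B)"

locale icd_category = hom_involutive_symmetric_monoidal_category C
  for C :: "('o, 'a, 'z) icd_category_scheme" (structure) +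
  assumes copy_hom: "A \<in> Obj C \<Longrightarrow> copy A \<in> Hom C A (A \<odot> A)"
    and del_hom: "A \<in> Obj C \<Longrightarrow> del A \<in> Hom C A \<I>"
    and copy_coassoc: "A \<in> Obj C \<Longrightarrow> \<a> A A A \<cdot> (copy A \<otimes> id A) \<cdot> copy A = (id A \<otimes> copy A) \<cdot> copy A"
    and copy_counit_left: "A \<in> Obj C \<Longrightarrow> \<l> A \<cdot> (del A \<otimes> id A) \<cdot> copy A = id A"
    and copy_counit_right: "A \<in> Obj C \<Longrightarrow> \<r> A \<cdot> (id A \<otimes> del A) \<cdot> copy A = id A"
    and conj_copy: "A \<in> Obj C \<Longrightarrow> conj (copy A) = swap A A \<cdot> copy A"
    and conj_del: "A \<in> Obj C \<Longrightarrow> conj (del A) = del A"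
    and copy_tensor: "\<lbrakk>A \<in> Obj C; B \<in> Obj C\<rbrakk> \<Longrightarrow> copy (A \<odot> B) = middle_swap C A B \<cdot> (copy A \<otimes> copy B)"
    and del_tensor: "\<lbrakk>A \<in> Obj C; B \<in> Obj C\<rbrakk> \<Longrightarrow> del (A \<odot> B) = \<l> \<I> \<cdot> (del A \<otimes> del B)"
    and del_unit: "del \<I> = id \<I>"
    and copy_unit: "\<l> \<I> \<cdot> copy \<I> = id \<I>"

definition self_adjoint :: "('o, 'a, 'z) icd_category_scheme \<Rightarrow> 'a \<Rightarrow> bool" where
  "self_adjoint C f \<longleftrightarrow> conj\<^bsub>C\<^esub> f = f"

definition total_arr :: "('o, 'a, 'z) icd_category_scheme \<Rightarrow> 'a \<Rightarrow> bool" where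
  "total_arr C f \<longleftrightarrow> del\<^bsub>C\<^esub> (Cod C f) \<cdot>\<^bsub>C\<^esub> f = del\<^bsub>C\<^esub> (Dom C f)"

definition deterministic :: "('o, 'a, 'z) icd_category_scheme \<Rightarrow> 'a \<Rightarrow> bool" where
  "deterministic C f \<longleftrightarrow>
     self_adjoint C f \<and> total_arr C f \<and>
     copy\<^bsub>C\<^esub> (Cod C f) \<cdot>\<^bsub>C\<^esub> f = (f \<otimes>\<^bsub>C\<^esub> f) \<cdot>\<^bsub>C\<^esub> copy\<^bsub>C\<^esub> (Dom C f)"

(* A functor F together with candidate coherence morphisms
   Fmult A B : F A \<odot> F B \<rightarrow> F (A \<odot> B) and Funit : I \<rightarrow> F I. *)
record ('o1, 'a1, 'o2, 'a2) monoidal_functor_data =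
  Fobj :: "'o1 \<Rightarrow> 'o2"
  Farr :: "'a1 \<Rightarrow> 'a2"
  Fmult :: "'o1 \<Rightarrow> 'o1 \<Rightarrow> 'a2"
  Funit :: "'a2"

locale strong_symmetric_monoidal_functor =
  C: symmetric_monoidal_category C + D: symmetric_monoidal_category D
  for C :: "('o1, 'a1, 'z1) symmetric_monoidal_category_scheme"
    and D :: "('o2, 'a2, 'z2) symmetric_monoidal_category_scheme"
    and F :: "('o1, 'a1, 'o2, 'a2) monoidal_functor_data" +
  assumes fobj: "A \<in> Obj C \<Longrightarrow> Fobj F A \<in> Obj D"
    and farr: "f \<in> Hom C X Y \<Longrightarrow> Farr F f \<in> Hom D (Fobj F X) (Fobj F Y)"
    and farr_ident: "A \<in> Obj C \<Longrightarrow> Farr F (id\<^bsub>C\<^esub> A) = id\<^bsub>D\<^esub> (Fobj F A)"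
    and farr_comp: "\<lbrakk>f \<in> Hom C X Y; g \<in> Hom C Y Z\<rbrakk> \<Longrightarrow>
          Farr F (g \<cdot>\<^bsub>C\<^esub> f) = Farr F g \<cdot>\<^bsub>D\<^esub> Farr F f"
    and fmult_hom: "\<lbrakk>A \<in> Obj C; B \<in> Obj C\<rbrakk> \<Longrightarrow>
          Fmult F A B \<in> Hom D (Fobj F A \<odot>\<^bsub>D\<^esub> Fobj F B) (Fobj F (A \<odot>\<^bsub>C\<^esub> B))"
    and fmult_iso: "\<lbrakk>A \<in> Obj C; B \<in> Obj C\<rbrakk> \<Longrightarrow> is_iso D (Fmult F A B)"
    and fmult_natural: "\<lbrakk>f \<in> Hom C A A'; g \<in> Hom C B B'\<rbrakk> \<Longrightarrow>
          Fmult F A' B' \<cdot>\<^bsub>D\<^esub> (Farr F f \<otimes>\<^bsub>D\<^esub> Farr F g) = Farr F (f \<otimes>\<^bsub>C\<^esub> g) \<cdot>\<^bsub>D\<^esub> Fmult F A B"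
    and funit_hom: "Funit F \<in> Hom D \<I>\<^bsub>D\<^esub> (Fobj F \<I>\<^bsub>C\<^esub>)"
    and funit_iso: "is_iso D (Funit F)"
    and fmult_assoc: "\<lbrakk>A \<in> Obj C; B \<in> Obj C; E \<in> Obj C\<rbrakk> \<Longrightarrow>
          Farr F (\<a>\<^bsub>C\<^esub> A B E) \<cdot>\<^bsub>D\<^esub> Fmult F (A \<odot>\<^bsub>C\<^esub> B) E \<cdot>\<^bsub>D\<^esub> (Fmult F A B \<otimes>\<^bsub>D\<^esub> id\<^bsub>D\<^esub> (Fobj F E)) =
          Fmult F A (B \<odot>\<^bsub>C\<^esub> E) \<cdot>\<^bsub>D\<^esub> (id\<^bsub>D\<^esub> (Fobj F A) \<otimes>\<^bsub>D\<^esub> Fmult F B E)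
            \<cdot>\<^bsub>D\<^esub> \<a>\<^bsub>D\<^esub> (Fobj F A) (Fobj F B) (Fobj F E)"
    and fmult_unit_left: "A \<in> Obj C \<Longrightarrow>
          Farr F (\<l>\<^bsub>C\<^esub> A) \<cdot>\<^bsub>D\<^esub> Fmult F \<I>\<^bsub>C\<^esub> A \<cdot>\<^bsub>D\<^esub> (Funit F \<otimes>\<^bsub>D\<^esub> id\<^bsub>D\<^esub> (Fobj F A)) = \<l>\<^bsub>D\<^esub> (Fobj F A)"
    and fmult_unit_right: "A \<in> Obj C \<Longrightarrow>
          Farr F (\<r>\<^bsub>C\<^esub> A) \<cdot>\<^bsub>D\<^esub> Fmult F A \<I>\<^bsub>C\<^esub> \<cdot>\<^bsub>D\<^esub> (id\<^bsub>D\<^esub> (Fobj F A) \<otimes>\<^bsub>D\<^esub> Funit F) = \<r>\<^bsub>D\<^esub> (Fobj F A)"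
    and fmult_swap: "\<lbrakk>A \<in> Obj C; B \<in> Obj C\<rbrakk> \<Longrightarrow>
          Farr F (swap\<^bsub>C\<^esub> A B) \<cdot>\<^bsub>D\<^esub> Fmult F A B = Fmult F B A \<cdot>\<^bsub>D\<^esub> swap\<^bsub>D\<^esub> (Fobj F A) (Fobj F B)"

locale strong_icd_functor =
  C: icd_category C + D: icd_category D + strong_symmetric_monoidal_functor C D F
  for C :: "('o1, 'a1, 'z1) icd_category_scheme"
    and D :: "('o2, 'a2, 'z2) icd_category_scheme"
    and F :: "('o1, 'a1, 'o2, 'a2) monoidal_functor_data" +
  assumes farr_conj: "f \<in> Arr C \<Longrightarrow> Farr F (conj\<^bsub>C\<^esub> f) = conj\<^bsub>D\<^esub> (Farr F f)"
    and fmult_self_adjoint: "\<lbrakk>A \<in> Obj C; B \<in> Obj C\<rbrakk> \<Longrightarrow> self_adjoint D (Fmult F A B)"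
    and funit_self_adjoint: "self_adjoint D (Funit F)"
    and fmult_copy: "A \<in> Obj C \<Longrightarrow>
          Fmult F A A \<cdot>\<^bsub>D\<^esub> copy\<^bsub>D\<^esub> (Fobj F A) = Farr F (copy\<^bsub>C\<^esub> A)"
    and funit_del: "A \<in> Obj C \<Longrightarrow> Funit F \<cdot>\<^bsub>D\<^esub> del\<^bsub>D\<^esub> (Fobj F A) = Farr F (del\<^bsub>C\<^esub> A)"

definition id_functor :: "('o, 'a, 'z) monoidal_category_scheme \<Rightarrow> ('o, 'a, 'o, 'a) monoidal_functor_data" where
  "id_functor C =
     \<lparr>Fobj = (\<lambda>A. A), Farr = (\<lambda>f. f),
      Fmult = (\<lambda>A B. id\<^bsub>C\<^esub> (A \<odot>\<^bsub>C\<^esub> B)), Funit = id\<^bsub>C\<^esub> \<I>\<^bsub>C\<^esub>\<rparr>"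

(* comp_functor E G F is G after F, where E is the codomain of G. *)
definition comp_functor ::
  "('o3, 'a3, 'z) category_scheme \<Rightarrow> ('o2, 'a2, 'o3, 'a3) monoidal_functor_data \<Rightarrow>
   ('o1, 'a1, 'o2, 'a2) monoidal_functor_data \<Rightarrow> ('o1, 'a1, 'o3, 'a3) monoidal_functor_data" where
  "comp_functor E G F =
     \<lparr>Fobj = (\<lambda>A. Fobj G (Fobj F A)), Farr = (\<lambda>f. Farr G (Farr F f)),
      Fmult = (\<lambda>A B. Farr G (Fmult F A B) \<cdot>\<^bsub>E\<^esub> Fmult G (Fobj F A) (Fobj F B)),
      Funit = Farr G (Funit F) \<cdot>\<^bsub>E\<^esub> Funit G\<rparr>"

locale icd_natural_transformation =
  F: strong_icd_functor C D F + G: strong_icd_functor C D G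
  for C :: "('o1, 'a1, 'z1) icd_category_scheme"
    and D :: "('o2, 'a2, 'z2) icd_category_scheme"
    and F G :: "('o1, 'a1, 'o2, 'a2) monoidal_functor_data"
    and \<eta> :: "'o1 \<Rightarrow> 'a2" +
  assumes component_hom: "A \<in> Obj C \<Longrightarrow> \<eta> A \<in> Hom D (Fobj F A) (Fobj G A)"
    and natural: "f \<in> Hom C A B \<Longrightarrow> \<eta> B \<cdot>\<^bsub>D\<^esub> Farr F f = Farr G f \<cdot>\<^bsub>D\<^esub> \<eta> A"
    and component_tensor: "\<lbrakk>A \<in> Obj C; B \<in> Obj C\<rbrakk> \<Longrightarrow>
          \<eta> (A \<odot>\<^bsub>C\<^esub> B) \<cdot>\<^bsub>D\<^esub> Fmult F A B = Fmult G A B \<cdot>\<^bsub>D\<^esub> (\<eta> A \<otimes>\<^bsub>D\<^esub> \<eta> B)"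
    and component_unit: "\<eta> \<I>\<^bsub>C\<^esub> \<cdot>\<^bsub>D\<^esub> Funit F = Funit G"
    and component_deterministic: "A \<in> Obj C \<Longrightarrow> deterministic D (\<eta> A)"

definition icd_natural_isomorphism ::
  "('o1, 'a1, 'z1) icd_category_scheme \<Rightarrow> ('o2, 'a2, 'z2) icd_category_scheme \<Rightarrow>
   ('o1, 'a1, 'o2, 'a2) monoidal_functor_data \<Rightarrow> ('o1, 'a1, 'o2, 'a2) monoidal_functor_data \<Rightarrow>
   ('o1 \<Rightarrow> 'a2) \<Rightarrow> bool" where
  "icd_natural_isomorphism C D F G \<eta> \<longleftrightarrow>
     icd_natural_transformation C D F G \<eta> \<and>
     (\<exists>\<theta>. icd_natural_transformation C D G F \<theta> \<and> (\<forall>A \<in> Obj C. inverse_arrows D (\<eta> A) (\<theta> A)))"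

definition icd_equivalence ::
  "('o1, 'a1, 'z1) icd_category_scheme \<Rightarrow> ('o2, 'a2, 'z2) icd_category_scheme \<Rightarrow>
   ('o1, 'a1, 'o2, 'a2) monoidal_functor_data \<Rightarrow> bool" where
  "icd_equivalence C D F \<longleftrightarrow>
     strong_icd_functor C D F \<and>
     (\<exists>G. strong_icd_functor D C G \<and>
          (\<exists>\<epsilon>. icd_natural_isomorphism D D (comp_functor D F G) (id_functor D) \<epsilon>) \<and>
          (\<exists>\<eta>. icd_natural_isomorphism C C (comp_functor C G F) (id_functor C) \<eta>))"

end

theory Submission
  imports Defs
begin

text \<open>The objects of the strict category are finite lists of objects of \<open>C\<close>, read as formal products. A list
  \<open>v\<close> evaluates to an actual product \<open>\<Otimes> v\<close>, and an arrow from \<open>v\<close> to \<open>w\<close> is an arrow of \<open>C\<close> from \<open>\<Otimes> v\<close>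
  to \<open>\<Otimes> w\<close> tagged with the two lists. Evaluation is then full and faithful by construction, every object \<open>A\<close>
  is the value of the one-letter list \<open>[A]\<close>, and concatenation is associative and unital on the nose.
  There are canonical isomorphisms \<open>\<mu> v w\<close> from \<open>\<Otimes> v \<odot> \<Otimes> w\<close> to \<open>\<Otimes> (v @ w)\<close>, composed of associators and
  unitors. All structure of \<open>C\<close> is carried to lists along them: arrows are tensored by conjugating with \<open>\<mu>\<close>, a list
  is copied by copying its value and merging the two copies, and so on. Identities can serve as associators
  and unitors because \<open>\<mu>\<close> is itself associative up to the associator of \<open>C\<close> (\<open>merge_assoc\<close>); this is where
  the pentagon and its consequences for units enter.
  
  An axiom about the copying of a single object is inherited by conjugation. The axiom that determines the copying of a
  product is not, for conjugating it would require that \<open>\<mu>\<close> commutes with copying, hence that all associators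
  and unitors of \<open>C\<close> do. That is a coherence statement about six tensor factors and
  many associators, unpleasant to verify in \<open>C\<close>. It is avoided by induction on the first list: for a single
  letter and a nonempty list \<open>\<mu>\<close> is an identity, and there the axiom is the one of \<open>C\<close>
  (\<open>copy_strictification_append\<close>); the induction step takes place in the strict category, where it amounts to
  the associativity of the interchange of middle factors, a short consequence of the hexagon (\<open>middle_swap_assoc\<close>).
  
  The equivalence is evaluation, with quasi-inverse \<open>A \<mapsto> [A]\<close>. Evaluating \<open>[A]\<close> gives \<open>A\<close> back, and \<open>[\<Otimes> v]\<close> is
  isomorphic to \<open>v\<close> by the arrow tagged from the identity of \<open>\<Otimes> v\<close>; both natural isomorphisms have
  identities underneath, so that their determinism costs nothing.\<close>

section \<open>Typed calculation in categories\<close>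

text \<open>The axioms are stated for hom-sets, with the endpoints as parameters. The rules below restate them in terms of
  domains and codomains, which the simplifier can compute; equations between typed composites then become rewriting
  problems. Where an equation has to apply inside a longer right-nested composite, a second version has a
  trailing factor \<open>k\<close>.\<close>

lemma Hom_iff: "f \<in> Hom C X Y \<longleftrightarrow> f \<in> Arr C \<and> Dom C f = X \<and> Cod C f = Y"
  by (simp add: Hom_def)

context category
begin

lemma ident_arr [simp]:
  assumes "A \<in> Obj C"
  shows "id A \<in> Arr C" "Dom C (id A) = A" "Cod C (id A) = A"
  using ident_hom[OF assms] by (simp_all add: Hom_iff)

lemma comp_arr [simp]:
  assumes "f \<in> Arr C" "g \<in> Arr C" "Dom C g = Cod C f"
  shows "g \<cdot> f \<in> Arr C" "Dom C (g \<cdot> f) = Dom C f" "Cod C (g \<cdot> f) = Cod C g"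
  using comp_hom[of f "Dom C f" "Cod C f" g "Cod C g"] assms by (simp_all add: Hom_iff)

lemmas arr_obj [simp] = dom_obj cod_obj

lemma comp_ident [simp]:
  assumes "f \<in> Arr C"
  shows "Cod C f = Y \<Longrightarrow> id Y \<cdot> f = f" "Dom C f = X \<Longrightarrow> f \<cdot> id X = f"
  using comp_ident_left[of f "Dom C f" "Cod C f"] comp_ident_right[of f "Dom C f" "Cod C f"] assms
  by (auto simp add: Hom_iff)

lemma comp_assoc_arr:
  assumes "f \<in> Arr C" "g \<in> Arr C" "h \<in> Arr C" "Dom C g = Cod C f" "Dom C h = Cod C g"
  shows "(h \<cdot> g) \<cdot> f = h \<cdot> g \<cdot> f"
  using comp_assoc[of f "Dom C f" "Cod C f" g "Cod C g" h "Cod C h"] assms by (simp add: Hom_iff)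

lemma inverse_arrows_iff:
  "inverse_arrows C f g \<longleftrightarrow> f \<in> Arr C \<and> g \<in> Arr C \<and> Dom C g = Cod C f \<and> Cod C g = Dom C f \<and>
     g \<cdot> f = id (Dom C f) \<and> f \<cdot> g = id (Cod C f)"
  by (auto simp: inverse_arrows_def Hom_iff)

lemma inverse_arrows_unique:
  assumes "inverse_arrows C f g" "inverse_arrows C f h"
  shows "g = h"
proof -
  have "g = (h \<cdot> f) \<cdot> g"
    using assms by (simp add: inverse_arrows_iff)
  also have "\<dots> = h \<cdot> (f \<cdot> g)"
    by (rule comp_assoc_arr) (use assms in \<open>auto simp: inverse_arrows_iff\<close>)
  also have "\<dots> = h"
    using assms by (simp add: inverse_arrows_iff)
  finally show ?thesis .
qed

lemma inverse_of_eq: "inverse_arrows C f g \<Longrightarrow> inverse_of C f = g"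
  unfolding inverse_of_def by (blast intro: inverse_arrows_unique)

lemma inverse_arrows_inverse_of: "is_iso C f \<Longrightarrow> inverse_arrows C f (inverse_of C f)"
  unfolding is_iso_def by (metis inverse_of_eq)

lemma inverse_of_arr [simp]:
  assumes "is_iso C f"
  shows "inverse_of C f \<in> Arr C" "Dom C (inverse_of C f) = Cod C f" "Cod C (inverse_of C f) = Dom C f"
    "inverse_of C f \<cdot> f = id (Dom C f)" "f \<cdot> inverse_of C f = id (Cod C f)"
  using inverse_arrows_inverse_of[OF assms] by (simp_all add: inverse_arrows_iff)

lemma iso_arr: "is_iso C f \<Longrightarrow> f \<in> Arr C"
  by (auto simp: is_iso_def inverse_arrows_iff)

lemma inverse_of_cancel [simp]:
  assumes "is_iso C f" "g \<in> Arr C"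
  shows "Cod C g = Dom C f \<Longrightarrow> inverse_of C f \<cdot> f \<cdot> g = g"
    "Cod C g = Cod C f \<Longrightarrow> f \<cdot> inverse_of C f \<cdot> g = g"
  by (use assms in \<open>simp_all add: iso_arr flip: comp_assoc_arr\<close>)

lemma iso_cancel_left:
  assumes "is_iso C h" "h \<cdot> f = h \<cdot> g" "f \<in> Arr C" "g \<in> Arr C" "Cod C f = Dom C h" "Cod C g = Dom C h"
  shows "f = g"
  using assms(2) inverse_of_cancel(1)[OF assms(1,3,5)] inverse_of_cancel(1)[OF assms(1,4,6)] by metis

lemma iso_cancel_right:
  assumes "is_iso C h" "f \<cdot> h = g \<cdot> h" "f \<in> Arr C" "g \<in> Arr C" "Dom C f = Cod C h" "Dom C g = Cod C h"
  shows "f = g"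
proof -
  have "f = (f \<cdot> h) \<cdot> inverse_of C h" "g = (g \<cdot> h) \<cdot> inverse_of C h"
    by (simp_all only: comp_assoc_arr iso_arr inverse_of_arr comp_ident assms(1,3-6))
  then show ?thesis
    using assms(2) by simp
qed

lemma is_isoI: "\<lbrakk>f \<in> Arr C; g \<in> Arr C; Dom C g = Cod C f; Cod C g = Dom C f;
    g \<cdot> f = id (Dom C f); f \<cdot> g = id (Cod C f)\<rbrakk> \<Longrightarrow> is_iso C f"
  unfolding is_iso_def by (auto simp: inverse_arrows_iff)

lemma is_iso_ident [simp]: "A \<in> Obj C \<Longrightarrow> is_iso C (id A)"
  by (rule is_isoI[of _ "id A"]) auto

lemma inverse_of_ident [simp]: "A \<in> Obj C \<Longrightarrow> inverse_of C (id A) = id A"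
  by (rule inverse_of_eq) (simp add: inverse_arrows_iff)

lemma is_iso_comp [simp]:
  assumes "is_iso C f" "is_iso C g" "Dom C g = Cod C f"
  shows "is_iso C (g \<cdot> f)"
  by (rule is_isoI[of _ "inverse_of C f \<cdot> inverse_of C g"])
     (use assms in \<open>simp_all add: iso_arr comp_assoc_arr\<close>)

end

context monoidal_category
begin

lemmas obj_simps [simp] = unit_obj tensor_obj

lemma tensor_arr [simp]:
  assumes "f \<in> Arr C" "g \<in> Arr C"
  shows "f \<otimes> g \<in> Arr C" "Dom C (f \<otimes> g) = Dom C f \<odot> Dom C g" "Cod C (f \<otimes> g) = Cod C f \<odot> Cod C g"
  using tensor_hom[of f "Dom C f" "Cod C f" g "Dom C g" "Cod C g"] assms by (simp_all add: Hom_iff)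

lemmas tensor_ident_simp [simp] = tensor_ident

lemma interchange [simp]:
  assumes "f \<in> Arr C" "g \<in> Arr C" "f' \<in> Arr C" "g' \<in> Arr C" "Dom C g = Cod C f" "Dom C g' = Cod C f'"
  shows "(g \<otimes> g') \<cdot> (f \<otimes> f') = (g \<cdot> f) \<otimes> (g' \<cdot> f')"
    "h \<in> Arr C \<Longrightarrow> Cod C h = Dom C f \<odot> Dom C f' \<Longrightarrow>
      (g \<otimes> g') \<cdot> (f \<otimes> f') \<cdot> h = ((g \<cdot> f) \<otimes> (g' \<cdot> f')) \<cdot> h"
proof -
  show *: "(g \<otimes> g') \<cdot> (f \<otimes> f') = (g \<cdot> f) \<otimes> (g' \<cdot> f')"
    using tensor_comp[of f "Dom C f" "Cod C f" g "Cod C g" f' "Dom C f'" "Cod C f'" g' "Cod C g'"] assms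
    by (simp add: Hom_iff)
  show "(g \<otimes> g') \<cdot> (f \<otimes> f') \<cdot> h = ((g \<cdot> f) \<otimes> (g' \<cdot> f')) \<cdot> h"
    if "h \<in> Arr C" "Cod C h = Dom C f \<odot> Dom C f'"
    unfolding *[symmetric] by (rule comp_assoc_arr[symmetric]) (use that assms in auto)
qed

lemma assoc_arr [simp]:
  assumes "A \<in> Obj C" "B \<in> Obj C" "D \<in> Obj C"
  shows "\<a> A B D \<in> Arr C" "Dom C (\<a> A B D) = (A \<odot> B) \<odot> D" "Cod C (\<a> A B D) = A \<odot> (B \<odot> D)"
  using assoc_hom[OF assms] by (simp_all add: Hom_iff)

lemma unitor_arr [simp]:
  assumes "A \<in> Obj C"
  shows "\<l> A \<in> Arr C" "Dom C (\<l> A) = \<I> \<odot> A" "Cod C (\<l> A) = A"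
    "\<r> A \<in> Arr C" "Dom C (\<r> A) = A \<odot> \<I>" "Cod C (\<r> A) = A"
  using left_unitor_hom[OF assms] right_unitor_hom[OF assms] by (simp_all add: Hom_iff)

lemmas coherence_iso [simp] = assoc_iso left_unitor_iso right_unitor_iso

lemma is_iso_tensor [simp]:
  assumes "is_iso C f" "is_iso C g"
  shows "is_iso C (f \<otimes> g)"
  by (rule is_isoI[of _ "inverse_of C f \<otimes> inverse_of C g"])
     (use assms in \<open>simp_all add: iso_arr comp_assoc_arr\<close>)

lemma assoc_natural_arr:
  assumes "f \<in> Arr C" "g \<in> Arr C" "h \<in> Arr C" "Cod C f = A" "Cod C g = B" "Cod C h = D"
  shows "\<a> A B D \<cdot> ((f \<otimes> g) \<otimes> h) = (f \<otimes> (g \<otimes> h)) \<cdot> \<a> (Dom C f) (Dom C g) (Dom C h)"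
    "k \<in> Arr C \<Longrightarrow> Cod C k = (Dom C f \<odot> Dom C g) \<odot> Dom C h \<Longrightarrow>
      \<a> A B D \<cdot> ((f \<otimes> g) \<otimes> h) \<cdot> k = (f \<otimes> (g \<otimes> h)) \<cdot> \<a> (Dom C f) (Dom C g) (Dom C h) \<cdot> k"
proof -
  show *: "\<a> A B D \<cdot> ((f \<otimes> g) \<otimes> h) = (f \<otimes> (g \<otimes> h)) \<cdot> \<a> (Dom C f) (Dom C g) (Dom C h)"
    using assoc_natural[of f "Dom C f" "Cod C f" g "Dom C g" "Cod C g" h "Dom C h" "Cod C h"] assms
    by (simp add: Hom_iff)
  show "\<a> A B D \<cdot> ((f \<otimes> g) \<otimes> h) \<cdot> k = (f \<otimes> (g \<otimes> h)) \<cdot> \<a> (Dom C f) (Dom C g) (Dom C h) \<cdot> k"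
    if "k \<in> Arr C" "Cod C k = (Dom C f \<odot> Dom C g) \<odot> Dom C h"
  proof -
    have "\<a> A B D \<cdot> ((f \<otimes> g) \<otimes> h) \<cdot> k = (\<a> A B D \<cdot> ((f \<otimes> g) \<otimes> h)) \<cdot> k"
      by (rule comp_assoc_arr[symmetric]) (use that assms in auto)
    also have "\<dots> = (f \<otimes> (g \<otimes> h)) \<cdot> \<a> (Dom C f) (Dom C g) (Dom C h) \<cdot> k"
      unfolding * by (rule comp_assoc_arr) (use that assms in auto)
    finally show ?thesis .
  qed
qed

lemma unitor_natural_arr:
  assumes "f \<in> Arr C" "Cod C f = B"
  shows "\<l> B \<cdot> (id \<I> \<otimes> f) = f \<cdot> \<l> (Dom C f)" "\<r> B \<cdot> (f \<otimes> id \<I>) = f \<cdot> \<r> (Dom C f)"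
    "k \<in> Arr C \<Longrightarrow> Cod C k = \<I> \<odot> Dom C f \<Longrightarrow> \<l> B \<cdot> (id \<I> \<otimes> f) \<cdot> k = f \<cdot> \<l> (Dom C f) \<cdot> k"
    "k \<in> Arr C \<Longrightarrow> Cod C k = Dom C f \<odot> \<I> \<Longrightarrow> \<r> B \<cdot> (f \<otimes> id \<I>) \<cdot> k = f \<cdot> \<r> (Dom C f) \<cdot> k"
proof -
  have [simp]: "B \<in> Obj C"
    using assms by auto
  show *: "\<l> B \<cdot> (id \<I> \<otimes> f) = f \<cdot> \<l> (Dom C f)" "\<r> B \<cdot> (f \<otimes> id \<I>) = f \<cdot> \<r> (Dom C f)"
    using left_unitor_natural right_unitor_natural assms by (auto simp: Hom_iff)
  show "\<l> B \<cdot> (id \<I> \<otimes> f) \<cdot> k = f \<cdot> \<l> (Dom C f) \<cdot> k"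
    if "k \<in> Arr C" "Cod C k = \<I> \<odot> Dom C f"
    using that assms *(1) by (simp flip: comp_assoc_arr)
  show "\<r> B \<cdot> (f \<otimes> id \<I>) \<cdot> k = f \<cdot> \<r> (Dom C f) \<cdot> k"
    if "k \<in> Arr C" "Cod C k = Dom C f \<odot> \<I>"
    using that assms *(2) by (simp flip: comp_assoc_arr)
qed

section \<open>Unit coherence in a monoidal category\<close>

text \<open>Naturality of the unitors exhibits \<open>id \<I> \<otimes> f\<close> as a conjugate of \<open>f\<close>; hence tensoring with the unit
  cancels.\<close>

lemma unit_tensor_faithful:
  assumes "\<And>f. f \<in> {g, h} \<Longrightarrow> f \<in> Hom C X Y"
  shows "id \<I> \<otimes> g = id \<I> \<otimes> h \<Longrightarrow> g = h" "g \<otimes> id \<I> = h \<otimes> id \<I> \<Longrightarrow> g = h"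
proof -
  have gh: "g \<in> Hom C X Y" "h \<in> Hom C X Y" and arr: "g \<in> Arr C" "h \<in> Arr C"
    "Dom C g = X" "Dom C h = X" "Cod C g = Y" "Cod C h = Y" "X \<in> Obj C"
    using assms[of g] assms[of h] by (auto simp: Hom_iff)
  show "g = h" if "id \<I> \<otimes> g = id \<I> \<otimes> h"
    using iso_cancel_right[of "\<l> X" g h] left_unitor_natural[OF gh(1)] left_unitor_natural[OF gh(2)]
      that arr by simp
  show "g = h" if "g \<otimes> id \<I> = h \<otimes> id \<I>"
    using iso_cancel_right[of "\<r> X" g h] right_unitor_natural[OF gh(1)] right_unitor_natural[OF gh(2)]
      that arr by simp
qed

text \<open>After tensoring with \<open>\<I>\<close> on the left, both sides become composable with two sides of the pentagon for
  \<open>\<I>, \<I>, A, B\<close>, whose remaining sides are resolved by the triangle. This and the next two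
  lemmas are Kelly's redundancy results: the unit laws of a monoidal category that follow from pentagon and triangle.\<close>

lemma left_unitor_tensor:
  assumes [simp]: "A \<in> Obj C" "B \<in> Obj C"
  shows "\<l> (A \<odot> B) \<cdot> \<a> \<I> A B = \<l> A \<otimes> id B"
proof (rule unit_tensor_faithful(1))
  show "\<And>f. f \<in> {\<l> (A \<odot> B) \<cdot> \<a> \<I> A B, \<l> A \<otimes> id B} \<Longrightarrow> f \<in> Hom C ((\<I> \<odot> A) \<odot> B) (A \<odot> B)"
    by (auto simp: Hom_iff)
  let ?p = "\<a> \<I> (\<I> \<odot> A) B \<cdot> (\<a> \<I> \<I> A \<otimes> id B)"
  have "(id \<I> \<otimes> (\<l> (A \<odot> B) \<cdot> \<a> \<I> A B)) \<cdot> ?p =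
      (id \<I> \<otimes> \<l> (A \<odot> B)) \<cdot> (id \<I> \<otimes> \<a> \<I> A B) \<cdot> ?p"
    by simp
  also have "\<dots> = (id \<I> \<otimes> \<l> (A \<odot> B)) \<cdot> \<a> \<I> \<I> (A \<odot> B) \<cdot> \<a> (\<I> \<odot> \<I>) A B"
    by (simp add: pentagon del: interchange)
  also have "\<dots> = ((id \<I> \<otimes> \<l> (A \<odot> B)) \<cdot> \<a> \<I> \<I> (A \<odot> B)) \<cdot> \<a> (\<I> \<odot> \<I>) A B"
    by (simp add: comp_assoc_arr)
  also have "\<dots> = (\<r> \<I> \<otimes> (id A \<otimes> id B)) \<cdot> \<a> (\<I> \<odot> \<I>) A B"
    by (simp add: triangle)
  also have "\<dots> = \<a> \<I> A B \<cdot> ((\<r> \<I> \<otimes> id A) \<otimes> id B)"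
    by (simp add: assoc_natural_arr)
  also have "\<dots> = \<a> \<I> A B \<cdot> ((id \<I> \<otimes> \<l> A) \<otimes> id B) \<cdot> (\<a> \<I> \<I> A \<otimes> id B)"
    by (simp add: triangle)
  also have "\<dots> = (id \<I> \<otimes> (\<l> A \<otimes> id B)) \<cdot> ?p"
    by (simp add: assoc_natural_arr del: interchange)
  finally show "id \<I> \<otimes> (\<l> (A \<odot> B) \<cdot> \<a> \<I> A B) = id \<I> \<otimes> (\<l> A \<otimes> id B)"
    by (rule iso_cancel_right[rotated]) auto
qed

text \<open>The mirror image: tensor with \<open>\<I>\<close> on the right and use the pentagon for \<open>A, B, \<I>, \<I>\<close>.\<close>

lemma right_unitor_tensor:
  assumes [simp]: "A \<in> Obj C" "B \<in> Obj C"
  shows "(id A \<otimes> \<r> B) \<cdot> \<a> A B \<I> = \<r> (A \<odot> B)"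
proof (rule unit_tensor_faithful(2))
  show "\<And>f. f \<in> {(id A \<otimes> \<r> B) \<cdot> \<a> A B \<I>, \<r> (A \<odot> B)} \<Longrightarrow> f \<in> Hom C ((A \<odot> B) \<odot> \<I>) (A \<odot> B)"
    by (auto simp: Hom_iff)
  have "\<a> A B \<I> \<cdot> (((id A \<otimes> \<r> B) \<cdot> \<a> A B \<I>) \<otimes> id \<I>) =
      \<a> A B \<I> \<cdot> ((id A \<otimes> \<r> B) \<otimes> id \<I>) \<cdot> (\<a> A B \<I> \<otimes> id \<I>)"
    by simp
  also have "\<dots> = (id A \<otimes> (\<r> B \<otimes> id \<I>)) \<cdot> \<a> A (B \<odot> \<I>) \<I> \<cdot> (\<a> A B \<I> \<otimes> id \<I>)"
    by (simp add: assoc_natural_arr del: interchange)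
  also have "\<dots> = (id A \<otimes> (id B \<otimes> \<l> \<I>)) \<cdot> (id A \<otimes> \<a> B \<I> \<I>) \<cdot> \<a> A (B \<odot> \<I>) \<I> \<cdot> (\<a> A B \<I> \<otimes> id \<I>)"
    by (simp add: triangle)
  also have "\<dots> = (id A \<otimes> (id B \<otimes> \<l> \<I>)) \<cdot> \<a> A B (\<I> \<odot> \<I>) \<cdot> \<a> (A \<odot> B) \<I> \<I>"
    by (simp add: pentagon del: interchange)
  also have "\<dots> = \<a> A B \<I> \<cdot> ((id A \<otimes> id B) \<otimes> \<l> \<I>) \<cdot> \<a> (A \<odot> B) \<I> \<I>"
    by (simp add: assoc_natural_arr del: tensor_ident_simp)
  also have "\<dots> = \<a> A B \<I> \<cdot> (\<r> (A \<odot> B) \<otimes> id \<I>)"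
    by (simp add: triangle)
  finally show "((id A \<otimes> \<r> B) \<cdot> \<a> A B \<I>) \<otimes> id \<I> = \<r> (A \<odot> B) \<otimes> id \<I>"
    by (rule iso_cancel_left[rotated]) auto
qed

text \<open>Naturality gives \<open>id \<I> \<otimes> \<l> \<I> = \<l> (\<I> \<odot> \<I>)\<close>, after which the triangle and \<open>left_unitor_tensor\<close> have the same left-hand
  side.\<close>

lemma left_unitor_unit: "\<l> \<I> = \<r> \<I>"
proof (rule unit_tensor_faithful(2))
  show "\<And>f. f \<in> {\<l> \<I>, \<r> \<I>} \<Longrightarrow> f \<in> Hom C (\<I> \<odot> \<I>) \<I>"
    by (auto simp: Hom_iff)
  have "\<l> \<I> \<cdot> (id \<I> \<otimes> \<l> \<I>) = \<l> \<I> \<cdot> \<l> (\<I> \<odot> \<I>)"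
    by (rule left_unitor_natural) (simp add: Hom_iff)
  then have "id \<I> \<otimes> \<l> \<I> = \<l> (\<I> \<odot> \<I>)"
    by (rule iso_cancel_left[rotated]) auto
  then show "\<l> \<I> \<otimes> id \<I> = \<r> \<I> \<otimes> id \<I>"
    using triangle[of \<I> \<I>] left_unitor_tensor[of \<I> \<I>] by simp
qed

end

section \<open>Tensor products of lists of objects\<close>

text \<open>A one-letter list evaluates to its letter and not to \<open>A \<odot> \<I>\<close>. Thus \<open>A \<mapsto> [A]\<close> is a section of evaluation
  on the nose, and \<open>\<mu> [A] w\<close> is an identity for nonempty \<open>w\<close>. The price is a separate treatment of
  empty lists.\<close>

fun tensor_list :: "('o, 'a, 'z) monoidal_category_scheme \<Rightarrow> 'o list \<Rightarrow> 'o"  ("\<Otimes>\<index>") where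
  "tensor_list C [] = \<I>\<^bsub>C\<^esub>"
| "tensor_list C [A] = A"
| "tensor_list C (A # B # v) = A \<odot>\<^bsub>C\<^esub> tensor_list C (B # v)"

fun merge :: "('o, 'a, 'z) monoidal_category_scheme \<Rightarrow> 'o list \<Rightarrow> 'o list \<Rightarrow> 'a"  ("\<mu>\<index>") where
  "merge C [] w = \<l>\<^bsub>C\<^esub> (tensor_list C w)"
| "merge C (A # v) [] = \<r>\<^bsub>C\<^esub> (tensor_list C (A # v))"
| "merge C [A] (B # w) = id\<^bsub>C\<^esub> (A \<odot>\<^bsub>C\<^esub> tensor_list C (B # w))"
| "merge C (A # A' # v) (B # w) =
     (id\<^bsub>C\<^esub> A \<otimes>\<^bsub>C\<^esub> merge C (A' # v) (B # w))
     \<cdot>\<^bsub>C\<^esub> \<a>\<^bsub>C\<^esub> A (tensor_list C (A' # v)) (tensor_list C (B # w))"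

context monoidal_category
begin

abbreviation words :: "'o list set" where
  "words \<equiv> lists (Obj C)"

lemma tensor_list_Cons: "v \<noteq> [] \<Longrightarrow> \<Otimes> (A # v) = A \<odot> \<Otimes> v"
  by (cases v) auto

lemma merge_Nil_right [simp]: "\<mu> v [] = \<r> (\<Otimes> v)"
  by (cases v) (auto simp: left_unitor_unit)

lemma merge_singleton: "w \<noteq> [] \<Longrightarrow> \<mu> [A] w = id (A \<odot> \<Otimes> w)"
  by (cases w) auto

lemma merge_Cons:
  "\<lbrakk>v \<noteq> []; w \<noteq> []\<rbrakk> \<Longrightarrow> \<mu> (A # v) w = (id A \<otimes> \<mu> v w) \<cdot> \<a> A (\<Otimes> v) (\<Otimes> w)"
  by (cases v; cases w) auto

lemma tensor_list_obj [simp]: "v \<in> words \<Longrightarrow> \<Otimes> v \<in> Obj C"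
proof (induction v)
  case (Cons A v)
  then show ?case
    by (cases "v = []") (auto simp: tensor_list_Cons)
qed auto

lemma merge_iso_hom:
  "\<lbrakk>v \<in> words; w \<in> words\<rbrakk> \<Longrightarrow> is_iso C (\<mu> v w) \<and> \<mu> v w \<in> Hom C (\<Otimes> v \<odot> \<Otimes> w) (\<Otimes> (v @ w))"
proof (induction v)
  case (Cons A v)
  consider "w = []" | "w \<noteq> []" "v = []" | "v \<noteq> []" "w \<noteq> []"
    by auto
  then show ?case
    using Cons by cases (auto simp: merge_singleton merge_Cons tensor_list_Cons Hom_iff)
qed (auto simp: Hom_iff)

lemma merge_arr [simp]:
  assumes "v \<in> words" "w \<in> words"
  shows "is_iso C (\<mu> v w)" "\<mu> v w \<in> Arr C" "Dom C (\<mu> v w) = \<Otimes> v \<odot> \<Otimes> w" "Cod C (\<mu> v w) = \<Otimes> (v @ w)"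
  using merge_iso_hom[OF assms] by (auto simp: Hom_iff)

text \<open>The coherence theorem on which strictness rests: the two ways of merging three lists agree up to the associator. If
  one of the lists is empty, the claim is one of the three unit laws (\<open>left_unitor_tensor\<close>, the triangle,
  \<open>right_unitor_tensor\<close>). Otherwise \<open>\<mu> (A # u) v\<close> is built from \<open>\<mu> u v\<close> by one associator, and
  moving this associator past the induction hypothesis is the pentagon for \<open>A, \<Otimes> u, \<Otimes> v, \<Otimes> w\<close>.\<close>

lemma merge_assoc:
  assumes "u \<in> words" "v \<in> words" "w \<in> words"
  shows "\<mu> (u @ v) w \<cdot> (\<mu> u v \<otimes> id (\<Otimes> w)) =
    \<mu> u (v @ w) \<cdot> (id (\<Otimes> u) \<otimes> \<mu> v w) \<cdot> \<a> (\<Otimes> u) (\<Otimes> v) (\<Otimes> w)"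
  using assms
proof (induction u)
  case Nil
  then show ?case
    by (simp add: unitor_natural_arr left_unitor_tensor)
next
  case (Cons A u)
  have [simp]: "A \<in> Obj C" "u \<in> words" "v \<in> words" "w \<in> words"
    using Cons.hyps Cons.prems by auto
  consider "v = []" | "w = []" | "v \<noteq> []" "w \<noteq> []" "u = []" | "v \<noteq> []" "w \<noteq> []" "u \<noteq> []"
    by blast
  then show ?case
  proof cases
    case 1
    then show ?thesis
      by (simp add: triangle)
  next
    case 2
    have "\<Otimes> (A # u) \<in> Obj C"
      by (rule tensor_list_obj) simp
    moreover have "\<mu> (A # u) v \<in> Arr C" "Cod C (\<mu> (A # u) v) = \<Otimes> (A # u @ v)"
      "Dom C (\<mu> (A # u) v) = \<Otimes> (A # u) \<odot> \<Otimes> v"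
      using merge_arr[of "A # u" v] by simp_all
    ultimately show ?thesis
      using 2 by (simp add: unitor_natural_arr right_unitor_tensor)
  next
    case 3
    then show ?thesis
      by (simp add: merge_singleton merge_Cons)
  next
    case 4
    let ?u = "\<Otimes> u" and ?v = "\<Otimes> v" and ?w = "\<Otimes> w"
    have "\<mu> ((A # u) @ v) w \<cdot> (\<mu> (A # u) v \<otimes> id ?w) =
        (id A \<otimes> \<mu> (u @ v) w) \<cdot> \<a> A (\<Otimes> (u @ v)) ?w \<cdot> ((id A \<otimes> \<mu> u v) \<otimes> id ?w) \<cdot> (\<a> A ?u ?v \<otimes> id ?w)"
      using 4 by (simp add: merge_Cons comp_assoc_arr)
    also have "\<dots> = (id A \<otimes> (\<mu> (u @ v) w \<cdot> (\<mu> u v \<otimes> id ?w))) \<cdot> \<a> A (?u \<odot> ?v) ?w \<cdot> (\<a> A ?u ?v \<otimes> id ?w)"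
      by (simp add: assoc_natural_arr del: interchange) simp
    also have "\<dots> = (id A \<otimes> (\<mu> u (v @ w) \<cdot> (id ?u \<otimes> \<mu> v w))) \<cdot>
        (id A \<otimes> \<a> ?u ?v ?w) \<cdot> \<a> A (?u \<odot> ?v) ?w \<cdot> (\<a> A ?u ?v \<otimes> id ?w)"
      using Cons.IH by (simp add: comp_assoc_arr)
    also have "\<dots> = (id A \<otimes> \<mu> u (v @ w)) \<cdot> (id A \<otimes> (id ?u \<otimes> \<mu> v w)) \<cdot> \<a> A ?u (?v \<odot> ?w) \<cdot> \<a> (A \<odot> ?u) ?v ?w"
      by (subst pentagon) auto
    also have "\<dots> = (id A \<otimes> \<mu> u (v @ w)) \<cdot> \<a> A ?u (\<Otimes> (v @ w)) \<cdot> ((id A \<otimes> id ?u) \<otimes> \<mu> v w) \<cdot> \<a> (A \<odot> ?u) ?v ?w"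
      by (simp add: assoc_natural_arr del: interchange tensor_ident_simp)
    also have "\<dots> = \<mu> (A # u) (v @ w) \<cdot> (id (\<Otimes> (A # u)) \<otimes> \<mu> v w) \<cdot> \<a> (\<Otimes> (A # u)) ?v ?w"
      using 4 by (simp add: merge_Cons tensor_list_Cons comp_assoc_arr)
    finally show ?thesis .
  qed
qed

lemma merge_assoc_comp:
  assumes "u \<in> words" "v \<in> words" "w \<in> words" "k \<in> Arr C" "Cod C k = (\<Otimes> u \<odot> \<Otimes> v) \<odot> \<Otimes> w"
  shows "\<mu> (u @ v) w \<cdot> (\<mu> u v \<otimes> id (\<Otimes> w)) \<cdot> k =
    \<mu> u (v @ w) \<cdot> (id (\<Otimes> u) \<otimes> \<mu> v w) \<cdot> \<a> (\<Otimes> u) (\<Otimes> v) (\<Otimes> w) \<cdot> k"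
proof -
  have "\<mu> (u @ v) w \<cdot> (\<mu> u v \<otimes> id (\<Otimes> w)) \<cdot> k = (\<mu> (u @ v) w \<cdot> (\<mu> u v \<otimes> id (\<Otimes> w))) \<cdot> k"
    using assms by (simp add: comp_assoc_arr)
  then show ?thesis
    using assms by (simp add: merge_assoc comp_assoc_arr)
qed

end

section \<open>The strictification\<close>

text \<open>Arrows are tagged with both lists because different lists may have equal values. Conjugation by \<open>\<mu>\<close> is what
  makes evaluation preserve tensors and swaps up to \<open>\<mu>\<close>, and copies are merged because \<open>\<mu> v v\<close> compares the two
  meanings of a doubled list.\<close>

definition strictification ::
  "('o, 'a, 'z) icd_category_scheme \<Rightarrow> ('o list, 'o list \<times> 'a \<times> 'o list) icd_category" where
  "strictification C =
     \<lparr>Obj = lists (Obj C),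
      Arr = {(v, f, w) | v f w. v \<in> lists (Obj C) \<and> w \<in> lists (Obj C) \<and>
               f \<in> Hom C (tensor_list C v) (tensor_list C w)},
      Dom = (\<lambda>f. fst f),
      Cod = (\<lambda>f. snd (snd f)),
      Ident = (\<lambda>v. (v, id\<^bsub>C\<^esub> (tensor_list C v), v)),
      Comp = (\<lambda>g f. (fst f, fst (snd g) \<cdot>\<^bsub>C\<^esub> fst (snd f), snd (snd g))),
      Tensor_obj = (@),
      Tensor_arr = (\<lambda>f g. (fst f @ fst g,
        merge C (snd (snd f)) (snd (snd g)) \<cdot>\<^bsub>C\<^esub> (fst (snd f) \<otimes>\<^bsub>C\<^esub> fst (snd g))
          \<cdot>\<^bsub>C\<^esub> inverse_of C (merge C (fst f) (fst g)),
        snd (snd f) @ snd (snd g))),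
      Unit_obj = [],
      Assoc = (\<lambda>u v w. (u @ v @ w, id\<^bsub>C\<^esub> (tensor_list C (u @ v @ w)), u @ v @ w)),
      Left_unitor = (\<lambda>v. (v, id\<^bsub>C\<^esub> (tensor_list C v), v)),
      Right_unitor = (\<lambda>v. (v, id\<^bsub>C\<^esub> (tensor_list C v), v)),
      Swap = (\<lambda>v w. (v @ w,
        merge C w v \<cdot>\<^bsub>C\<^esub> swap\<^bsub>C\<^esub> (tensor_list C v) (tensor_list C w) \<cdot>\<^bsub>C\<^esub> inverse_of C (merge C v w),
        w @ v)),
      Conj = (\<lambda>f. (fst f, conj\<^bsub>C\<^esub> (fst (snd f)), snd (snd f))),
      Copy = (\<lambda>v. (v, merge C v v \<cdot>\<^bsub>C\<^esub> copy\<^bsub>C\<^esub> (tensor_list C v), v @ v)),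
      Del = (\<lambda>v. (v, del\<^bsub>C\<^esub> (tensor_list C v), []))\<rparr>"

abbreviation underlying :: "'o list \<times> 'a \<times> 'o list \<Rightarrow> 'a" where
  "underlying f \<equiv> fst (snd f)"

context symmetric_monoidal_category
begin

lemma swap_arr [simp]:
  assumes "A \<in> Obj C" "B \<in> Obj C"
  shows "swap A B \<in> Arr C" "Dom C (swap A B) = A \<odot> B" "Cod C (swap A B) = B \<odot> A"
    "swap B A \<cdot> swap A B = id (A \<odot> B)"
  using swap_hom[OF assms] swap_swap[OF assms] by (simp_all add: Hom_iff)

lemma swap_cancel [simp]:
  "\<lbrakk>A \<in> Obj C; B \<in> Obj C; k \<in> Arr C; Cod C k = A \<odot> B\<rbrakk> \<Longrightarrow> swap B A \<cdot> swap A B \<cdot> k = k"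
  by (simp flip: comp_assoc_arr)

lemma swap_natural_arr:
  assumes "f \<in> Arr C" "g \<in> Arr C" "Cod C f = A" "Cod C g = B"
  shows "swap A B \<cdot> (f \<otimes> g) = (g \<otimes> f) \<cdot> swap (Dom C f) (Dom C g)"
    "k \<in> Arr C \<Longrightarrow> Cod C k = Dom C f \<odot> Dom C g \<Longrightarrow>
      swap A B \<cdot> (f \<otimes> g) \<cdot> k = (g \<otimes> f) \<cdot> swap (Dom C f) (Dom C g) \<cdot> k"
proof -
  have [simp]: "A \<in> Obj C" "B \<in> Obj C"
    using assms by auto
  show *: "swap A B \<cdot> (f \<otimes> g) = (g \<otimes> f) \<cdot> swap (Dom C f) (Dom C g)"
    using swap_natural assms by (auto simp: Hom_iff)
  show "swap A B \<cdot> (f \<otimes> g) \<cdot> k = (g \<otimes> f) \<cdot> swap (Dom C f) (Dom C g) \<cdot> k"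
    if "k \<in> Arr C" "Cod C k = Dom C f \<odot> Dom C g"
    using that assms * by (simp flip: comp_assoc_arr)
qed

lemma is_iso_swap [simp]: "\<lbrakk>A \<in> Obj C; B \<in> Obj C\<rbrakk> \<Longrightarrow> is_iso C (swap A B)"
  by (rule is_isoI[of _ "swap B A"]) auto

end

context icd_category
begin

abbreviation S where
  "S \<equiv> strictification C"

lemma strictification_simps [simp]:
  "Obj S = words"
  "Dom S (v, f, w) = v" "Cod S (v, f, w) = w"
  "Ident S v = (v, id (\<Otimes> v), v)"
  "Tensor_obj S v w = v @ w"
  "Unit_obj S = []"
  "Assoc S u v w = Ident S (u @ v @ w)"
  "Left_unitor S v = Ident S v"
  "Right_unitor S v = Ident S v"
  "Swap S v w = (v @ w, \<mu> w v \<cdot> swap (\<Otimes> v) (\<Otimes> w) \<cdot> inverse_of C (\<mu> v w), w @ v)"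
  "Copy S v = (v, \<mu> v v \<cdot> copy (\<Otimes> v), v @ v)"
  "Del S v = (v, del (\<Otimes> v), [])"
  "Conj S (v, x, w) = (v, conj x, w)"
  by (auto simp: strictification_def)

text \<open>When laws about \<open>\<mu>\<close> are applied, the arrows below are best left folded; under these names their unfolding can be
  switched off.\<close>

lemmas ident_strictification = strictification_simps(4)
  and swap_strictification = strictification_simps(10)
  and copy_strictification = strictification_simps(11)
  and del_strictification = strictification_simps(12)

lemma strictification_arrI:
  "\<lbrakk>Dom S f \<in> words; Cod S f \<in> words; underlying f \<in> Arr C;
     Dom C (underlying f) = \<Otimes> (Dom S f); Cod C (underlying f) = \<Otimes> (Cod S f)\<rbrakk> \<Longrightarrow> f \<in> Arr S"
  by (cases f) (auto simp: strictification_def Hom_iff)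

lemma strictification_arrow_simps [simp]:
  "Dom S (Comp S g f) = Dom S f" "Cod S (Comp S g f) = Cod S g"
  "Dom S (Tensor_arr S g f) = Dom S g @ Dom S f" "Cod S (Tensor_arr S g f) = Cod S g @ Cod S f"
  "Dom S (Conj S f) = Dom S f" "Cod S (Conj S f) = Cod S f"
  "underlying (Comp S g f) = underlying g \<cdot> underlying f"
  "underlying (Tensor_arr S f g) = \<mu> (Cod S f) (Cod S g) \<cdot> (underlying f \<otimes> underlying g)
     \<cdot> inverse_of C (\<mu> (Dom S f) (Dom S g))"
  "underlying (Conj S f) = conj (underlying f)"
  by (auto simp: strictification_def)

lemmas underlying_tensor = strictification_arrow_simps(8)

lemma strictification_arr_eqI:
  "\<lbrakk>Dom S f = Dom S g; Cod S f = Cod S g; underlying f = underlying g\<rbrakk> \<Longrightarrow> f = g"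
  by (auto simp: strictification_def prod_eq_iff)

lemma underlying_arr [simp]:
  assumes "f \<in> Arr S"
  shows "Dom S f \<in> words" "Cod S f \<in> words" "underlying f \<in> Arr C"
    "Dom C (underlying f) = \<Otimes> (Dom S f)" "Cod C (underlying f) = \<Otimes> (Cod S f)"
  using assms by (auto simp: strictification_def Hom_iff)

lemma comp_strictification_arr:
  "\<lbrakk>f \<in> Arr S; g \<in> Arr S; Dom S g = Cod S f\<rbrakk> \<Longrightarrow> Comp S g f \<in> Arr S"
  by (rule strictification_arrI) simp_all

lemma category_strictification: "category S"
proof unfold_locales
  fix f assume "f \<in> Arr S"
  then show "Dom S f \<in> Obj S" "Cod S f \<in> Obj S"
    by auto
next
  fix v assume "v \<in> Obj S"
  then show "Ident S v \<in> Hom S v v"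
    by (simp add: Hom_iff strictification_arrI)
next
  fix f g u v w assume "f \<in> Hom S u v" "g \<in> Hom S v w"
  then show "Comp S g f \<in> Hom S u w"
    by (auto simp: Hom_iff intro: comp_strictification_arr)
next
  fix f v w assume "f \<in> Hom S v w"
  then show "Comp S (Ident S w) f = f" "Comp S f (Ident S v) = f"
    by (auto simp: Hom_iff intro!: strictification_arr_eqI)
next
  fix f g h u v w x assume "f \<in> Hom S u v" "g \<in> Hom S v w" "h \<in> Hom S w x"
  then show "Comp S (Comp S h g) f = Comp S h (Comp S g f)"
    by (auto simp: Hom_iff comp_assoc_arr intro!: strictification_arr_eqI)
qed

text \<open>An arrow of the strictification is determined by its composite with any isomorphism onto the value of its domain. Taking
  a composite of \<open>\<mu>\<close>'s for this isomorphism clears the inverses that occur in tensors and swaps.\<close>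

lemma underlying_eqI:
  assumes "f \<in> Arr S" "g \<in> Arr S" "Dom S f = Dom S g" "Cod S f = Cod S g"
    and "is_iso C h" "Cod C h = \<Otimes> (Dom S g)" "underlying f \<cdot> h = underlying g \<cdot> h"
  shows "f = g"
  using assms by (intro strictification_arr_eqI iso_cancel_right[of h "underlying f" "underlying g"]) simp_all

lemma tensor_strictification_arr:
  "\<lbrakk>f \<in> Arr S; g \<in> Arr S\<rbrakk> \<Longrightarrow> Tensor_arr S f g \<in> Arr S"
  by (rule strictification_arrI) simp_all

text \<open>Naturality of \<open>\<mu>\<close>, in the form used to push \<open>\<mu>\<close> through a composite from the right.\<close>

lemma underlying_tensor_merge:
  assumes "f \<in> Arr S" "g \<in> Arr S" "Dom S f = v" "Dom S g = w" "k \<in> Arr C" "Cod C k = \<Otimes> v \<odot> \<Otimes> w"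
  shows "underlying (Tensor_arr S f g) \<cdot> \<mu> v w \<cdot> k =
    \<mu> (Cod S f) (Cod S g) \<cdot> (underlying f \<otimes> underlying g) \<cdot> k"
proof -
  have "v \<in> words" "w \<in> words"
    using underlying_arr(1)[OF assms(1)] underlying_arr(1)[OF assms(2)] assms(3,4) by simp_all
  then show ?thesis
    using assms(1,2,5,6) by (simp add: comp_assoc_arr flip: assms(3,4))
qed

text \<open>Precomposed with a merging of the three domains, both sides turn into \<open>f \<otimes> g \<otimes> h\<close> followed by a merging of the
  codomains; the two mergings are compared by \<open>merge_assoc\<close>, the two bracketings by naturality of the associator.\<close>

lemma tensor_strictification_assoc:
  assumes "f \<in> Arr S" "g \<in> Arr S" "h \<in> Arr S"
  shows "Tensor_arr S (Tensor_arr S f g) h = Tensor_arr S f (Tensor_arr S g h)"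
proof -
  obtain u v w where [simp]: "Dom S f = u" "Dom S g = v" "Dom S h = w"
    and [simp]: "u \<in> words" "v \<in> words" "w \<in> words"
    using assms by simp
  obtain u' v' w' where [simp]: "Cod S f = u'" "Cod S g = v'" "Cod S h = w'"
    and [simp]: "u' \<in> words" "v' \<in> words" "w' \<in> words"
    using assms by simp
  let ?h = "\<mu> (u @ v) w \<cdot> (\<mu> u v \<otimes> id (\<Otimes> w))"
  note [simp del] = underlying_tensor
  note [simp] = assms tensor_strictification_arr
  have "underlying (Tensor_arr S (Tensor_arr S f g) h) \<cdot> ?h =
     \<mu> (u' @ v') w' \<cdot> ((underlying (Tensor_arr S f g) \<cdot> \<mu> u v) \<otimes> underlying h)"
    by (simp add: underlying_tensor_merge)
  also have "underlying (Tensor_arr S f g) \<cdot> \<mu> u v = \<mu> u' v' \<cdot> (underlying f \<otimes> underlying g)"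
    using underlying_tensor_merge[of f g u v "id (\<Otimes> u \<odot> \<Otimes> v)"] by simp
  also have "\<mu> (u' @ v') w' \<cdot> ((\<mu> u' v' \<cdot> (underlying f \<otimes> underlying g)) \<otimes> underlying h) =
     \<mu> (u' @ v') w' \<cdot> (\<mu> u' v' \<otimes> id (\<Otimes> w')) \<cdot> ((underlying f \<otimes> underlying g) \<otimes> underlying h)"
    by simp
  also have "\<dots> = \<mu> u' (v' @ w') \<cdot> (underlying f \<otimes> (\<mu> v' w' \<cdot> (underlying g \<otimes> underlying h))) \<cdot>
      \<a> (\<Otimes> u) (\<Otimes> v) (\<Otimes> w)"
    by (simp add: merge_assoc_comp assoc_natural_arr del: interchange) simp
  also have "\<mu> v' w' \<cdot> (underlying g \<otimes> underlying h) = underlying (Tensor_arr S g h) \<cdot> \<mu> v w"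
    using underlying_tensor_merge[of g h v w "id (\<Otimes> v \<odot> \<Otimes> w)"] by simp
  also have "\<mu> u' (v' @ w') \<cdot> (underlying f \<otimes> (underlying (Tensor_arr S g h) \<cdot> \<mu> v w)) \<cdot> \<a> (\<Otimes> u) (\<Otimes> v) (\<Otimes> w) =
     underlying (Tensor_arr S f (Tensor_arr S g h)) \<cdot> ?h"
    by (simp add: merge_assoc underlying_tensor_merge)
  finally have "underlying (Tensor_arr S (Tensor_arr S f g) h) \<cdot> ?h =
     underlying (Tensor_arr S f (Tensor_arr S g h)) \<cdot> ?h" .
  then show ?thesis
    by (rule underlying_eqI[rotated -1]) simp_all
qed

lemma tensor_strictification_unit:
  assumes "f \<in> Arr S"
  shows "Tensor_arr S (Ident S []) f = f" "Tensor_arr S f (Ident S []) = f"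
  using assms by (auto intro!: strictification_arr_eqI simp: unitor_natural_arr)

lemma tensor_strictification_ident:
  "\<lbrakk>v \<in> words; w \<in> words\<rbrakk> \<Longrightarrow> Tensor_arr S (Ident S v) (Ident S w) = Ident S (v @ w)"
  by (rule strictification_arr_eqI) simp_all

lemma strict_monoidal_strictification: "strict_monoidal_category S"
proof -
  interpret S: category S
    by (rule category_strictification)
  show ?thesis
  proof unfold_locales
    fix f g v v' w w' assume "f \<in> Hom S v w" "g \<in> Hom S v' w'"
    then show "Tensor_arr S f g \<in> Hom S (Tensor_obj S v v') (Tensor_obj S w w')"
      by (auto simp: Hom_iff intro: tensor_strictification_arr)
  next
    fix f g f' g' u v w u' v' w'
    assume "f \<in> Hom S u v" "g \<in> Hom S v w" "f' \<in> Hom S u' v'" "g' \<in> Hom S v' w'"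
    then show "Tensor_arr S (Comp S g f) (Comp S g' f') = Comp S (Tensor_arr S g g') (Tensor_arr S f f')"
      by (auto simp: Hom_iff comp_assoc_arr intro!: strictification_arr_eqI)
  next
    fix f g h u v w u' v' w' assume "f \<in> Hom S u u'" "g \<in> Hom S v v'" "h \<in> Hom S w w'"
    then have [simp]: "f \<in> Arr S" "g \<in> Arr S" "h \<in> Arr S"
      and "Dom S f = u" "Dom S g = v" "Dom S h = w" "Cod S f = u'" "Cod S g = v'" "Cod S h = w'"
      by (auto simp: Hom_iff)
    then show "Comp S (Assoc S u' v' w') (Tensor_arr S (Tensor_arr S f g) h) =
        Comp S (Tensor_arr S f (Tensor_arr S g h)) (Assoc S u v w)"
      by (simp add: tensor_strictification_assoc tensor_strictification_arr del: ident_strictification)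
  next
    fix f v w assume "f \<in> Hom S v w"
    then show "Comp S (Left_unitor S w) (Tensor_arr S (Ident S (Unit_obj S)) f) = Comp S f (Left_unitor S v)"
      "Comp S (Right_unitor S w) (Tensor_arr S f (Ident S (Unit_obj S))) = Comp S f (Right_unitor S v)"
      by (simp_all add: Hom_iff tensor_strictification_unit del: ident_strictification)
  qed (auto simp: Hom_iff tensor_strictification_ident simp del: ident_strictification)
qed

lemma swap_strictification_arr: "\<lbrakk>v \<in> words; w \<in> words\<rbrakk> \<Longrightarrow> Swap S v w \<in> Arr S"
  by (rule strictification_arrI) simp_all

lemma underlying_swap_merge:
  assumes "v \<in> words" "w \<in> words" "k \<in> Arr C" "Cod C k = \<Otimes> v \<odot> \<Otimes> w"
  shows "underlying (Swap S v w) \<cdot> \<mu> v w \<cdot> k = \<mu> w v \<cdot> swap (\<Otimes> v) (\<Otimes> w) \<cdot> k"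
  using assms by (simp add: comp_assoc_arr)

text \<open>Only the hexagon takes work. Precomposed with a merging of \<open>u, v, w\<close>, each side becomes the corresponding side of the
  hexagon in \<open>C\<close> followed by a merging of \<open>v, w, u\<close>.\<close>

lemma symmetric_monoidal_strictification: "symmetric_monoidal_category S"
proof -
  interpret S: strict_monoidal_category S
    by (rule strict_monoidal_strictification)
  show ?thesis
  proof unfold_locales
    fix v w assume "v \<in> Obj S" "w \<in> Obj S"
    then have vw: "v \<in> words" "w \<in> words"
      by simp_all
    then show "Swap S v w \<in> Hom S (Tensor_obj S v w) (Tensor_obj S w v)"
      using swap_strictification_arr[of v w] by (simp add: Hom_iff)
    show "Comp S (Swap S w v) (Swap S v w) = Ident S (Tensor_obj S v w)"
      using vw by (intro strictification_arr_eqI) (simp_all add: comp_assoc_arr)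
  next
    fix f g v w v' w' assume "f \<in> Hom S v v'" "g \<in> Hom S w w'"
    then show "Comp S (Swap S v' w') (Tensor_arr S f g) = Comp S (Tensor_arr S g f) (Swap S v w)"
      by (auto simp: Hom_iff comp_assoc_arr swap_natural_arr intro!: strictification_arr_eqI)
  next
    fix u v w assume "u \<in> Obj S" "v \<in> Obj S" "w \<in> Obj S"
    then have [simp]: "u \<in> words" "v \<in> words" "w \<in> words"
      by simp_all
    note [simp del] = underlying_tensor ident_strictification swap_strictification
    note [simp] = tensor_strictification_arr swap_strictification_arr
    have *: "underlying (Swap S v w) \<cdot> \<mu> v w = \<mu> w v \<cdot> swap (\<Otimes> v) (\<Otimes> w)"
      if "v \<in> words" "w \<in> words" for v w
      using underlying_swap_merge[of v w "id (\<Otimes> v \<odot> \<Otimes> w)"] that by simp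
    have ds: "Dom S (Swap S v w) = v @ w" "Cod S (Swap S v w) = w @ v" for v w
      by (simp_all add: strictification_simps)
    have di: "Dom S (Ident S v) = v" "Cod S (Ident S v) = v" "underlying (Ident S v) = id (\<Otimes> v)" for v
      by (simp_all add: strictification_simps)
    let ?h = "\<mu> (u @ v) w \<cdot> (\<mu> u v \<otimes> id (\<Otimes> w))"
    let ?s = "\<lambda>u v. swap (\<Otimes> u) (\<Otimes> v)"
    have "underlying (Swap S u (v @ w)) \<cdot> ?h =
        \<mu> (v @ w) u \<cdot> swap (\<Otimes> u) (\<Otimes> (v @ w)) \<cdot> (id (\<Otimes> u) \<otimes> \<mu> v w) \<cdot> \<a> (\<Otimes> u) (\<Otimes> v) (\<Otimes> w)"
      by (simp add: merge_assoc underlying_swap_merge)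
    also have "\<dots> = \<mu> v (w @ u) \<cdot> (id (\<Otimes> v) \<otimes> \<mu> w u) \<cdot> \<a> (\<Otimes> v) (\<Otimes> w) (\<Otimes> u)
        \<cdot> swap (\<Otimes> u) (\<Otimes> v \<odot> \<Otimes> w) \<cdot> \<a> (\<Otimes> u) (\<Otimes> v) (\<Otimes> w)"
      by (simp add: swap_natural_arr merge_assoc_comp)
    also have "\<dots> = \<mu> v (w @ u) \<cdot> (id (\<Otimes> v) \<otimes> (\<mu> w u \<cdot> ?s u w)) \<cdot> \<a> (\<Otimes> v) (\<Otimes> u) (\<Otimes> w) \<cdot> (?s u v \<otimes> id (\<Otimes> w))"
      by (simp add: hexagon)
    also have "\<dots> = underlying (Tensor_arr S (Ident S v) (Swap S u w)) \<cdot>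
       \<mu> v (u @ w) \<cdot> (id (\<Otimes> v) \<otimes> \<mu> u w) \<cdot> \<a> (\<Otimes> v) (\<Otimes> u) (\<Otimes> w) \<cdot> (?s u v \<otimes> id (\<Otimes> w))"
      by (simp add: underlying_tensor_merge ds di *)
    also have "\<dots> = underlying (Tensor_arr S (Ident S v) (Swap S u w)) \<cdot>
       \<mu> (v @ u) w \<cdot> (\<mu> v u \<otimes> id (\<Otimes> w)) \<cdot> (?s u v \<otimes> id (\<Otimes> w))"
      by (simp add: merge_assoc_comp del: interchange)
    also have "\<dots> = underlying (Comp S (Tensor_arr S (Ident S v) (Swap S u w)) (Tensor_arr S (Swap S u v) (Ident S w))) \<cdot> ?h"
      by (simp add: underlying_tensor_merge ds di * comp_assoc_arr)
    finally have "Swap S u (v @ w) = Comp S (Tensor_arr S (Ident S v) (Swap S u w)) (Tensor_arr S (Swap S u v) (Ident S w))"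
      by (rule underlying_eqI[rotated -1]) (simp_all add: ds di comp_strictification_arr)
    then show "Comp S (Assoc S v w u) (Comp S (Swap S u (Tensor_obj S v w)) (Assoc S u v w)) =
        Comp S (Tensor_arr S (Ident S v) (Swap S u w)) (Comp S (Assoc S v u w) (Tensor_arr S (Swap S u v) (Ident S w)))"
      by (simp add: ds di)
  qed
qed

end

context hom_involutive_symmetric_monoidal_category
begin

lemma conj_arr [simp]:
  assumes "f \<in> Arr C"
  shows "conj f \<in> Arr C" "Dom C (conj f) = Dom C f" "Cod C (conj f) = Cod C f"
  using conj_hom[of f "Dom C f" "Cod C f"] assms by (simp_all add: Hom_iff)

lemma conj_comp_arr [simp]:
  "\<lbrakk>f \<in> Arr C; g \<in> Arr C; Dom C g = Cod C f\<rbrakk> \<Longrightarrow> conj (g \<cdot> f) = conj g \<cdot> conj f"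
  using conj_comp by (auto simp: Hom_iff)

lemmas conj_simps [simp] =
  conj_ident conj_conj conj_tensor conj_assoc conj_left_unitor conj_right_unitor conj_swap

lemma conj_inverse_of:
  assumes "is_iso C f" "conj f = f"
  shows "conj (inverse_of C f) = inverse_of C f"
proof -
  have f: "f \<in> Arr C"
    using assms(1) by (rule iso_arr)
  have "inverse_arrows C f (conj (inverse_of C f))"
    unfolding inverse_arrows_iff
    using assms f conj_comp_arr[of f "inverse_of C f"] conj_comp_arr[of "inverse_of C f" f] by simp
  then show ?thesis
    by (rule inverse_of_eq[symmetric])
qed

text \<open>As a composite of associators, unitors and identities, \<open>\<mu>\<close> is self-adjoint; hence conjugating with it commutes
  with the involution.\<close>

lemma conj_merge [simp]: "\<lbrakk>v \<in> words; w \<in> words\<rbrakk> \<Longrightarrow> conj (\<mu> v w) = \<mu> v w"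
proof (induction v)
  case (Cons A v)
  consider "w = []" | "w \<noteq> []" "v = []" | "v \<noteq> []" "w \<noteq> []"
    by auto
  then show ?case
    using Cons by cases (auto simp: merge_singleton merge_Cons tensor_list_Cons)
qed auto

end

context icd_category
begin

lemma conj_strictification_arr: "f \<in> Arr S \<Longrightarrow> Conj S f \<in> Arr S"
  by (rule strictification_arrI) simp_all

lemma hom_involutive_strictification: "hom_involutive_symmetric_monoidal_category S"
proof -
  interpret S: strict_monoidal_category S
    by (rule strict_monoidal_strictification)
  interpret S: symmetric_monoidal_category S
    by (rule symmetric_monoidal_strictification)
  show ?thesis
  proof unfold_locales
    fix f v w assume "f \<in> Hom S v w"
    then show "Conj S f \<in> Hom S v w"
      by (simp add: Hom_iff conj_strictification_arr)
  next
    fix f assume "f \<in> Arr S"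
    then show "Conj S (Conj S f) = f"
      by (auto intro!: strictification_arr_eqI)
  next
    fix f g u v w assume "f \<in> Hom S u v" "g \<in> Hom S v w"
    then show "Conj S (Comp S g f) = Comp S (Conj S g) (Conj S f)"
      by (auto simp: Hom_iff intro!: strictification_arr_eqI)
  next
    fix f g assume "f \<in> Arr S" "g \<in> Arr S"
    then show "Conj S (Tensor_arr S f g) = Tensor_arr S (Conj S f) (Conj S g)"
      by (auto simp: conj_inverse_of intro!: strictification_arr_eqI)
  qed (simp_all add: conj_inverse_of)
qed

end

section \<open>Interchanging the middle factors in a strict symmetric monoidal category\<close>

locale strict_symmetric_monoidal_category = strict_monoidal_category C + symmetric_monoidal_category C
  for C :: "('o, 'a, 'z) symmetric_monoidal_category_scheme" (structure)
begin

lemmas strict_simps [simp] =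
  strict_tensor_assoc strict_unit_left strict_unit_right strict_assoc strict_left_unitor strict_right_unitor

text \<open>Strictness is assumed on objects and structure isomorphisms. On arrows it follows by naturality of
  associators and unitors that are identities.\<close>

lemma strict_tensor_arr [simp]:
  assumes "f \<in> Arr C"
  shows "\<lbrakk>g \<in> Arr C; h \<in> Arr C\<rbrakk> \<Longrightarrow> (f \<otimes> g) \<otimes> h = f \<otimes> g \<otimes> h"
    "id \<I> \<otimes> f = f" "f \<otimes> id \<I> = f"
proof -
  show "(f \<otimes> g) \<otimes> h = f \<otimes> g \<otimes> h" if "g \<in> Arr C" "h \<in> Arr C"
    using assoc_natural_arr(1)[OF _ _ _ refl refl refl, of f g h] assms that by simp
  show "id \<I> \<otimes> f = f" "f \<otimes> id \<I> = f"
    using unitor_natural_arr(1,2)[of f] assms by simp_all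
qed

lemma swap_tensor_right:
  "\<lbrakk>A \<in> Obj C; B \<in> Obj C; D \<in> Obj C\<rbrakk> \<Longrightarrow> swap A (B \<odot> D) = (id B \<otimes> swap A D) \<cdot> (swap A B \<otimes> id D)"
  using hexagon[of A B D] by simp

text \<open>The second hexagon is the inverse of the first.\<close>

lemma swap_tensor_left:
  assumes [simp]: "A \<in> Obj C" "B \<in> Obj C" "D \<in> Obj C"
  shows "swap (A \<odot> B) D = (swap A D \<otimes> id B) \<cdot> (id A \<otimes> swap B D)"
proof -
  have "swap D (A \<odot> B) \<cdot> (swap A D \<otimes> id B) \<cdot> (id A \<otimes> swap B D) = id (A \<odot> B \<odot> D)"
    by (simp add: swap_tensor_right comp_assoc_arr)
  then have "swap D (A \<odot> B) \<cdot> swap (A \<odot> B) D = swap D (A \<odot> B) \<cdot> (swap A D \<otimes> id B) \<cdot> (id A \<otimes> swap B D)"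
    by (simp add: swap_arr(4)[of "A \<odot> B" D, simplified])
  then show ?thesis
    by (rule iso_cancel_left[rotated]) simp_all
qed

text \<open>The hexagon for \<open>A, \<I>, \<I>\<close> makes \<open>swap A \<I>\<close> idempotent, and an idempotent isomorphism is an identity.\<close>

lemma swap_unit [simp]:
  assumes [simp]: "A \<in> Obj C"
  shows "swap A \<I> = id A" "swap \<I> A = id A"
proof -
  have "swap A \<I> \<cdot> swap A \<I> = swap A \<I> \<cdot> id A"
    using swap_tensor_right[of A \<I> \<I>] by simp
  then show "swap A \<I> = id A"
    by (rule iso_cancel_left[rotated]) simp_all
  then show "swap \<I> A = id A"
    using swap_arr(4)[of A \<I>] by simp
qed

lemma middle_swap_strict:
  "\<lbrakk>A \<in> Obj C; B \<in> Obj C\<rbrakk> \<Longrightarrow> middle_swap C A B = id A \<otimes> swap A B \<otimes> id B"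
  by (simp add: middle_swap_def)

lemma middle_swap_arr [simp]:
  assumes "A \<in> Obj C" "B \<in> Obj C"
  shows "middle_swap C A B \<in> Arr C" "Dom C (middle_swap C A B) = A \<odot> A \<odot> B \<odot> B"
    "Cod C (middle_swap C A B) = A \<odot> B \<odot> A \<odot> B"
  using assms by (simp_all add: middle_swap_strict)

lemma middle_swap_unit [simp]:
  "A \<in> Obj C \<Longrightarrow> middle_swap C A \<I> = id (A \<odot> A)"
  "A \<in> Obj C \<Longrightarrow> middle_swap C \<I> A = id (A \<odot> A)"
  by (simp_all add: middle_swap_strict)

text \<open>Both sides rearrange \<open>A A B B D D\<close> into \<open>A B D A B D\<close> and fix the first factor. By the hexagons, what
  remains is on either side first \<open>swap A B\<close> beside \<open>swap B D\<close>, acting on disjoint factors, and then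
  \<open>swap A D\<close> (the arrow \<open>?p\<close>). The two sides differ only in the order of the first two swaps, and the interchange
  law makes that order irrelevant.\<close>

lemma middle_swap_assoc:
  assumes [simp]: "A \<in> Obj C" "B \<in> Obj C" "D \<in> Obj C"
  shows "middle_swap C A (B \<odot> D) \<cdot> (id (A \<odot> A) \<otimes> middle_swap C B D) =
    middle_swap C (A \<odot> B) D \<cdot> (middle_swap C A B \<otimes> id (D \<odot> D))"
proof -
  let ?p = "id B \<otimes> swap A D \<otimes> id (B \<odot> D)" and ?t = "swap B D \<otimes> id D"
  have "swap A (B \<odot> D) \<otimes> id (B \<odot> D) =
      ((id B \<otimes> swap A D) \<otimes> id (B \<odot> D)) \<cdot> ((swap A B \<otimes> id D) \<otimes> id (B \<odot> D))"
    by (simp add: swap_tensor_right del: strict_tensor_arr)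
  also have "\<dots> = ?p \<cdot> (swap A B \<otimes> id (D \<odot> B \<odot> D))"
    by simp
  finally have 1: "swap A (B \<odot> D) \<otimes> id (B \<odot> D) = ?p \<cdot> (swap A B \<otimes> id (D \<odot> B \<odot> D))" .
  have "swap (A \<odot> B) D \<otimes> id D = ((swap A D \<otimes> id B) \<otimes> id D) \<cdot> ((id A \<otimes> swap B D) \<otimes> id D)"
    by (simp add: swap_tensor_left del: strict_tensor_arr)
  also have "\<dots> = (swap A D \<otimes> id (B \<odot> D)) \<cdot> (id A \<otimes> ?t)"
    by simp
  finally have 2: "id B \<otimes> swap (A \<odot> B) D \<otimes> id D = ?p \<cdot> (id B \<otimes> id A \<otimes> ?t)"
    by simp
  have id_tensor: "id X \<otimes> id Y \<otimes> f = id (X \<odot> Y) \<otimes> f" if "X \<in> Obj C" "Y \<in> Obj C" "f \<in> Arr C" for X Y f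
    using strict_tensor_arr(1)[of "id X" "id Y" f] that by simp
  have "middle_swap C A (B \<odot> D) \<cdot> (id (A \<odot> A) \<otimes> middle_swap C B D) =
      (id A \<otimes> (swap A (B \<odot> D) \<otimes> id (B \<odot> D))) \<cdot> (id A \<otimes> id A \<otimes> id B \<otimes> ?t)"
    by (simp add: middle_swap_strict id_tensor del: interchange)
  also have "\<dots> = id A \<otimes> (?p \<cdot> (swap A B \<otimes> ?t))"
    by (simp add: 1 id_tensor[of A B] comp_assoc_arr)
  also have "\<dots> = (id A \<otimes> (id B \<otimes> swap (A \<odot> B) D \<otimes> id D)) \<cdot> (id A \<otimes> (swap A B \<otimes> id (B \<odot> D \<odot> D)))"
    by (simp add: 2 id_tensor[of B A] comp_assoc_arr)
  also have "\<dots> = middle_swap C (A \<odot> B) D \<cdot> (middle_swap C A B \<otimes> id (D \<odot> D))"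
    by (simp add: middle_swap_strict id_tensor del: interchange)
  finally show ?thesis .
qed

end

section \<open>Copying and deleting in the strictification\<close>

context icd_category
begin

lemma copy_del_arr [simp]:
  assumes "A \<in> Obj C"
  shows "copy A \<in> Arr C" "Dom C (copy A) = A" "Cod C (copy A) = A \<odot> A"
    "del A \<in> Arr C" "Dom C (del A) = A" "Cod C (del A) = \<I>"
  using copy_hom[OF assms] del_hom[OF assms] by (simp_all add: Hom_iff)

lemma middle_swap_arr [simp]:
  assumes "A \<in> Obj C" "B \<in> Obj C"
  shows "middle_swap C A B \<in> Arr C" "Dom C (middle_swap C A B) = (A \<odot> A) \<odot> (B \<odot> B)"
    "Cod C (middle_swap C A B) = (A \<odot> B) \<odot> (A \<odot> B)"
  using assms by (simp_all add: middle_swap_def)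

lemma strict_symmetric_strictification: "strict_symmetric_monoidal_category S"
  by (simp add: strict_symmetric_monoidal_category_def strict_monoidal_strictification
      symmetric_monoidal_strictification)

lemma copy_del_strictification_arr:
  "v \<in> words \<Longrightarrow> Copy S v \<in> Arr S" "v \<in> words \<Longrightarrow> Del S v \<in> Arr S"
  by (rule strictification_arrI; simp)+

lemma strictification_data_simps:
  "Dom S (Ident S v) = v" "Cod S (Ident S v) = v" "underlying (Ident S v) = id (\<Otimes> v)"
  "Dom S (Swap S v w) = v @ w" "Cod S (Swap S v w) = w @ v"
  "Dom S (Copy S v) = v" "Cod S (Copy S v) = v @ v" "underlying (Copy S v) = \<mu> v v \<cdot> copy (\<Otimes> v)"
  "Dom S (Del S v) = v" "Cod S (Del S v) = []" "underlying (Del S v) = del (\<Otimes> v)"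
  by simp_all

text \<open>Evaluation carries the interchange of middle factors to that of \<open>C\<close>, as any strong symmetric monoidal functor does.
  In the strictification it is the bare \<open>id \<otimes> swap \<otimes> id\<close>, while in \<open>C\<close> it contains four associators; these are
  produced by four applications of \<open>merge_assoc\<close>.\<close>

lemma underlying_middle_swap:
  assumes [simp]: "v \<in> words" "w \<in> words"
    and k: "k \<in> Arr C" "Cod C k = (\<Otimes> v \<odot> \<Otimes> v) \<odot> (\<Otimes> w \<odot> \<Otimes> w)"
  shows "underlying (middle_swap S v w) \<cdot> \<mu> (v @ v) (w @ w) \<cdot> (\<mu> v v \<otimes> \<mu> w w) \<cdot> k =
    \<mu> (v @ w) (v @ w) \<cdot> (\<mu> v w \<otimes> \<mu> v w) \<cdot> middle_swap C (\<Otimes> v) (\<Otimes> w) \<cdot> k"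
proof -
  interpret S: strict_symmetric_monoidal_category S
    by (rule strict_symmetric_strictification)
  note [simp del] = underlying_tensor ident_strictification swap_strictification
  note [simp] = strictification_data_simps k tensor_strictification_arr
    swap_strictification_arr
  let ?v = "\<Otimes> v" and ?w = "\<Otimes> w"
  let ?a' = "inverse_of C (\<a> ?v ?w ?w)" and ?s = "swap ?v ?w"
  have m: "middle_swap S v w = Tensor_arr S (Ident S v) (Tensor_arr S (Swap S v w) (Ident S w))"
    by (simp add: S.middle_swap_strict)
  have merge_swap: "underlying (Swap S v w) \<cdot> \<mu> v w = \<mu> w v \<cdot> ?s"
    using underlying_swap_merge[of v w "id (?v \<odot> ?w)"] by simp
  \<comment> \<open>On the last three factors \<open>v @ w @ w\<close>, regroup so that the swap acts on a merged pair.\<close>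
  have "\<mu> v (w @ w) \<cdot> (id ?v \<otimes> \<mu> w w) = \<mu> (v @ w) w \<cdot> (\<mu> v w \<otimes> id ?w) \<cdot> ?a'"
    using merge_assoc_comp[of v w w ?a'] by simp
  then have "underlying (Tensor_arr S (Swap S v w) (Ident S w)) \<cdot> \<mu> v (w @ w) \<cdot> (id ?v \<otimes> \<mu> w w)
     = \<mu> (w @ v) w \<cdot> (\<mu> w v \<otimes> id ?w) \<cdot> (?s \<otimes> id ?w) \<cdot> ?a'"
    by (simp add: underlying_tensor_merge merge_swap)
  also have "\<dots> = \<mu> w (v @ w) \<cdot> (id ?w \<otimes> \<mu> v w) \<cdot> \<a> ?w ?v ?w \<cdot> (?s \<otimes> id ?w) \<cdot> ?a'"
    by (simp add: merge_assoc_comp del: interchange)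
  finally have inner: "underlying (Tensor_arr S (Swap S v w) (Ident S w)) \<cdot> \<mu> v (w @ w) \<cdot> (id ?v \<otimes> \<mu> w w)
     = \<mu> w (v @ w) \<cdot> (id ?w \<otimes> \<mu> v w) \<cdot> \<a> ?w ?v ?w \<cdot> (?s \<otimes> id ?w) \<cdot> ?a'" .
  \<comment> \<open>This form of \<open>merge_assoc\<close> regroups a product of two products. It is applied to the domain \<open>v @ v @ w @ w\<close>
    and, backwards, to the codomain \<open>v @ w @ v @ w\<close>.\<close>
  have outer: "\<mu> (u @ v) w \<cdot> (\<mu> u v \<otimes> \<mu> x y) \<cdot> k =
      \<mu> u (v @ w) \<cdot> (id (\<Otimes> u) \<otimes> (\<mu> v w \<cdot> (id (\<Otimes> v) \<otimes> \<mu> x y))) \<cdot> \<a> (\<Otimes> u) (\<Otimes> v) (\<Otimes> x \<odot> \<Otimes> y) \<cdot> k"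
    if "u \<in> words" "v \<in> words" "x \<in> words" "y \<in> words" "w = x @ y"
      "k \<in> Arr C" "Cod C k = (\<Otimes> u \<odot> \<Otimes> v) \<odot> (\<Otimes> x \<odot> \<Otimes> y)" for u v w x y k
  proof -
    have "\<mu> (u @ v) w \<cdot> (\<mu> u v \<otimes> \<mu> x y) \<cdot> k =
        \<mu> (u @ v) w \<cdot> (\<mu> u v \<otimes> id (\<Otimes> w)) \<cdot> (id (\<Otimes> u \<odot> \<Otimes> v) \<otimes> \<mu> x y) \<cdot> k"
      using that by simp
    also have "\<dots> = \<mu> u (v @ w) \<cdot> (id (\<Otimes> u) \<otimes> \<mu> v w) \<cdot> \<a> (\<Otimes> u) (\<Otimes> v) (\<Otimes> w)
        \<cdot> ((id (\<Otimes> u) \<otimes> id (\<Otimes> v)) \<otimes> \<mu> x y) \<cdot> k"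
      using that by (simp add: merge_assoc_comp del: interchange)
    also have "\<dots> = \<mu> u (v @ w) \<cdot> (id (\<Otimes> u) \<otimes> (\<mu> v w \<cdot> (id (\<Otimes> v) \<otimes> \<mu> x y))) \<cdot>
        \<a> (\<Otimes> u) (\<Otimes> v) (\<Otimes> x \<odot> \<Otimes> y) \<cdot> k"
      using that by (simp add: assoc_natural_arr del: tensor_ident_simp)
    finally show ?thesis .
  qed
  have "underlying (middle_swap S v w) \<cdot> \<mu> (v @ v) (w @ w) \<cdot> (\<mu> v v \<otimes> \<mu> w w) \<cdot> k =
     \<mu> v (w @ v @ w) \<cdot> (id ?v \<otimes> (underlying (Tensor_arr S (Swap S v w) (Ident S w)) \<cdot>
        \<mu> v (w @ w) \<cdot> (id ?v \<otimes> \<mu> w w))) \<cdot> \<a> ?v ?v (?w \<odot> ?w) \<cdot> k"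
    by (simp add: outer m underlying_tensor_merge)
  also have "\<dots> = \<mu> v (w @ v @ w) \<cdot> (id ?v \<otimes> (\<mu> w (v @ w) \<cdot> (id ?w \<otimes> \<mu> v w))) \<cdot>
      (id ?v \<otimes> (\<a> ?w ?v ?w \<cdot> (?s \<otimes> id ?w) \<cdot> ?a')) \<cdot> \<a> ?v ?v (?w \<odot> ?w) \<cdot> k"
    unfolding inner by (simp add: comp_assoc_arr)
  also have "(id ?v \<otimes> (\<a> ?w ?v ?w \<cdot> (?s \<otimes> id ?w) \<cdot> ?a')) \<cdot> \<a> ?v ?v (?w \<odot> ?w) \<cdot> k =
      \<a> ?v ?w (?v \<odot> ?w) \<cdot> middle_swap C ?v ?w \<cdot> k"
    by (simp add: middle_swap_def comp_assoc_arr)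
  also have "\<mu> v (w @ v @ w) \<cdot> (id ?v \<otimes> (\<mu> w (v @ w) \<cdot> (id ?w \<otimes> \<mu> v w))) \<cdot>
      \<a> ?v ?w (?v \<odot> ?w) \<cdot> middle_swap C ?v ?w \<cdot> k =
      \<mu> (v @ w) (v @ w) \<cdot> (\<mu> v w \<otimes> \<mu> v w) \<cdot> middle_swap C ?v ?w \<cdot> k"
    by (simp add: outer)
  finally show ?thesis .
qed

text \<open>The hypothesis says that \<open>\<mu> v w\<close> commutes with copying. For \<open>v = [A]\<close> and nonempty \<open>w\<close> it is trivial, because
  \<open>\<mu> v w\<close> is an identity.\<close>

lemma copy_strictification_append:
  assumes [simp]: "v \<in> words" "w \<in> words"
    and merge: "copy (\<Otimes> (v @ w)) \<cdot> \<mu> v w = (\<mu> v w \<otimes> \<mu> v w) \<cdot> copy (\<Otimes> v \<odot> \<Otimes> w)"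
  shows "Copy S (v @ w) = Comp S (middle_swap S v w) (Tensor_arr S (Copy S v) (Copy S w))"
proof -
  interpret S: strict_symmetric_monoidal_category S
    by (rule strict_symmetric_strictification)
  note [simp del] = underlying_tensor ident_strictification swap_strictification copy_strictification
  note [simp] = strictification_data_simps tensor_strictification_arr
    swap_strictification_arr copy_del_strictification_arr
  let ?v = "\<Otimes> v" and ?w = "\<Otimes> w"
  let ?c = "copy ?v \<otimes> copy ?w"
  have "underlying (Comp S (middle_swap S v w) (Tensor_arr S (Copy S v) (Copy S w))) \<cdot> \<mu> v w =
      underlying (middle_swap S v w) \<cdot> \<mu> (v @ v) (w @ w) \<cdot> (\<mu> v v \<otimes> \<mu> w w) \<cdot> ?c"
    using S.middle_swap_arr[of v w] underlying_tensor_merge[of "Copy S v" "Copy S w" v w "id (?v \<odot> ?w)"]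
    by (simp add: comp_assoc_arr)
  also have "\<dots> = \<mu> (v @ w) (v @ w) \<cdot> (\<mu> v w \<otimes> \<mu> v w) \<cdot> middle_swap C ?v ?w \<cdot> ?c"
    using underlying_middle_swap[of v w ?c] by simp
  also have "\<dots> = underlying (Copy S (v @ w)) \<cdot> \<mu> v w"
    by (simp add: merge comp_assoc_arr copy_tensor)
  finally show ?thesis
    using S.middle_swap_arr[of v w]
    by (intro underlying_eqI[of _ _ "\<mu> v w"]) (simp_all add: comp_strictification_arr)
qed

lemma copy_strictification_Nil: "Copy S [] = Ident S []"
  by (rule strictification_arr_eqI) (simp_all add: copy_unit)

text \<open>Induction on the first list. Splitting off its head turns the claim into an equation between two ways of
  copying three objects at once, which \<open>middle_swap_assoc\<close> provides.\<close>

lemma copy_strictification_tensor: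
  "\<lbrakk>v \<in> words; w \<in> words\<rbrakk> \<Longrightarrow>
    Copy S (v @ w) = Comp S (middle_swap S v w) (Tensor_arr S (Copy S v) (Copy S w))"
proof (induction v)
  case Nil
  interpret S: strict_symmetric_monoidal_category S
    by (rule strict_symmetric_strictification)
  show ?case
    using Nil S.middle_swap_unit[of w] S.comp_ident(1)[of "Copy S w"]
    by (simp add: copy_strictification_Nil tensor_strictification_unit copy_del_strictification_arr
        strictification_data_simps del: ident_strictification copy_strictification)
next
  case (Cons A v)
  interpret S: strict_symmetric_monoidal_category S
    by (rule strict_symmetric_strictification)
  note [simp del] = underlying_tensor ident_strictification swap_strictification copy_strictification
  note [simp] = strictification_data_simps tensor_strictification_arr
    swap_strictification_arr copy_del_strictification_arr
  have [simp]: "A \<in> Obj C" "v \<in> words" "w \<in> words"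
    using Cons.prems by auto
  \<comment> \<open>The base of the argument: a single letter in front of an arbitrary list.\<close>
  have head: "Copy S (A # u) = Comp S (middle_swap S [A] u) (Tensor_arr S (Copy S [A]) (Copy S u))"
    if [simp]: "u \<in> words" for u
  proof (cases "u = []")
    case True
    then show ?thesis
      using S.middle_swap_unit[of "[A]"] S.comp_ident(1)[of "Copy S [A]"]
      by (simp add: copy_strictification_Nil tensor_strictification_unit)
  next
    case False
    then show ?thesis
      using copy_strictification_append[of "[A]" u] by (simp add: merge_singleton tensor_list_Cons)
  qed
  note [simp] = S.middle_swap_arr[simplified]
  let ?c = "Copy S"
  have "?c (A # v @ w) = Comp S (middle_swap S [A] (v @ w)) (Tensor_arr S (?c [A]) (?c (v @ w)))"
    by (rule head) simp
  also have "\<dots> = Comp S (Comp S (middle_swap S [A] (v @ w)) (Tensor_arr S (Ident S [A, A]) (middle_swap S v w)))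
      (Tensor_arr S (?c [A]) (Tensor_arr S (?c v) (?c w)))"
    using Cons by (simp add: S.comp_assoc_arr)
  also have "Comp S (middle_swap S [A] (v @ w)) (Tensor_arr S (Ident S [A, A]) (middle_swap S v w)) =
      Comp S (middle_swap S (A # v) w) (Tensor_arr S (middle_swap S [A] v) (Ident S (w @ w)))"
    using S.middle_swap_assoc[of "[A]" v w] by simp
  also have "Tensor_arr S (?c [A]) (Tensor_arr S (?c v) (?c w)) = Tensor_arr S (Tensor_arr S (?c [A]) (?c v)) (?c w)"
    by simp
  also have "Comp S (Comp S (middle_swap S (A # v) w) (Tensor_arr S (middle_swap S [A] v) (Ident S (w @ w)))) \<dots> =
      Comp S (middle_swap S (A # v) w) (Tensor_arr S (?c (A # v)) (?c w))"
    by (simp add: S.comp_assoc_arr head[of v] del: S.strict_tensor_arr)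
  finally show ?case
    by simp
qed

lemma del_strictification_Nil: "Del S [] = Ident S []"
  by (rule strictification_arr_eqI) (simp_all add: del_unit)

lemma del_strictification_tensor:
  "\<lbrakk>v \<in> words; w \<in> words\<rbrakk> \<Longrightarrow> Del S (v @ w) = Tensor_arr S (Del S v) (Del S w)"
proof (induction v)
  case Nil
  then show ?case
    by (simp add: del_strictification_Nil tensor_strictification_unit copy_del_strictification_arr
        del: ident_strictification del_strictification)
next
  case (Cons A v)
  note [simp del] = ident_strictification del_strictification
  have [simp]: "A \<in> Obj C" "v \<in> words" "w \<in> words"
    using Cons.prems by auto
  have head: "Del S (A # u) = Tensor_arr S (Del S [A]) (Del S u)" if [simp]: "u \<in> words" for u
  proof (cases "u = []")
    case True
    then show ?thesis
      by (simp add: del_strictification_Nil tensor_strictification_unit copy_del_strictification_arr)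
  next
    case False
    then show ?thesis
      by (intro strictification_arr_eqI)
         (simp_all add: merge_singleton tensor_list_Cons del_tensor strictification_data_simps)
  qed
  have "Del S (A # v @ w) = Tensor_arr S (Del S [A]) (Tensor_arr S (Del S v) (Del S w))"
    using head[of "v @ w"] Cons by simp
  also have "\<dots> = Tensor_arr S (Del S (A # v)) (Del S w)"
    by (simp add: head[of v] copy_del_strictification_arr tensor_strictification_assoc)
  finally show ?case
    by simp
qed

text \<open>The laws of coassociativity, counit and conjugation concern the value of one list at a time and reduce to those
  of \<open>C\<close> once \<open>\<mu>\<close> is moved to the left. The laws for products have been proved by induction
  above.\<close>

lemma icd_strictification: "icd_category S"
proof -
  interpret S: strict_symmetric_monoidal_category S
    by (rule strict_symmetric_strictification)
  interpret S: hom_involutive_symmetric_monoidal_category S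
    by (rule hom_involutive_strictification)
  show ?thesis
  proof unfold_locales
    fix v assume "v \<in> Obj S"
    then have [simp]: "v \<in> words"
      by simp
    show "Copy S v \<in> Hom S v (Tensor_obj S v v)" "Del S v \<in> Hom S v (Unit_obj S)"
      using copy_del_strictification_arr[of v] by (simp_all add: Hom_iff)
    show "Conj S (Copy S v) = Comp S (Swap S v v) (Copy S v)" "Conj S (Del S v) = Del S v"
      by (intro strictification_arr_eqI; simp add: conj_copy conj_del comp_assoc_arr)+
    note [simp del] = underlying_tensor ident_strictification swap_strictification copy_strictification del_strictification
    note [simp] = strictification_data_simps tensor_strictification_arr
      copy_del_strictification_arr
    let ?v = "\<Otimes> v"
    have "underlying (Comp S (Tensor_arr S (Copy S v) (Ident S v)) (Copy S v)) =
        \<mu> (v @ v) v \<cdot> (\<mu> v v \<otimes> id ?v) \<cdot> (copy ?v \<otimes> id ?v) \<cdot> copy ?v"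
      by (simp add: underlying_tensor_merge)
    also have "\<dots> = \<mu> v (v @ v) \<cdot> (id ?v \<otimes> \<mu> v v) \<cdot> \<a> ?v ?v ?v \<cdot> (copy ?v \<otimes> id ?v) \<cdot> copy ?v"
      by (simp add: merge_assoc_comp del: interchange)
    also have "\<dots> = underlying (Comp S (Tensor_arr S (Ident S v) (Copy S v)) (Copy S v))"
      by (simp add: copy_coassoc underlying_tensor_merge)
    finally have "Comp S (Tensor_arr S (Copy S v) (Ident S v)) (Copy S v) =
        Comp S (Tensor_arr S (Ident S v) (Copy S v)) (Copy S v)"
      by (intro strictification_arr_eqI) simp_all
    then show "Comp S (Assoc S v v v) (Comp S (Tensor_arr S (Copy S v) (Ident S v)) (Copy S v)) =
        Comp S (Tensor_arr S (Ident S v) (Copy S v)) (Copy S v)"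
      by (simp add: comp_strictification_arr)
    have "Comp S (Tensor_arr S (Del S v) (Ident S v)) (Copy S v) = Ident S v"
      by (rule strictification_arr_eqI) (simp_all add: underlying_tensor_merge copy_counit_left)
    then show "Comp S (Left_unitor S v) (Comp S (Tensor_arr S (Del S v) (Ident S v)) (Copy S v)) = Ident S v"
      by simp
    have "Comp S (Tensor_arr S (Ident S v) (Del S v)) (Copy S v) = Ident S v"
      by (rule strictification_arr_eqI) (simp_all add: underlying_tensor_merge copy_counit_right)
    then show "Comp S (Right_unitor S v) (Comp S (Tensor_arr S (Ident S v) (Del S v)) (Copy S v)) = Ident S v"
      by simp
  next
    fix v w assume "v \<in> Obj S" "w \<in> Obj S"
    then have vw: "v \<in> words" "w \<in> words"
      by simp_all
    then show "Copy S (Tensor_obj S v w) = Comp S (middle_swap S v w) (Tensor_arr S (Copy S v) (Copy S w))"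
      using copy_strictification_tensor[of v w] by simp
    show "Del S (Tensor_obj S v w) = Comp S (Left_unitor S (Unit_obj S)) (Tensor_arr S (Del S v) (Del S w))"
      using vw del_strictification_tensor[of v w] copy_del_strictification_arr(2)[of "v @ w"]
      by (simp add: strictification_data_simps del: ident_strictification del_strictification)
  next
    show "Del S (Unit_obj S) = Ident S (Unit_obj S)"
      by (simp add: del_strictification_Nil del: ident_strictification del_strictification)
    show "Comp S (Left_unitor S (Unit_obj S)) (Copy S (Unit_obj S)) = Ident S (Unit_obj S)"
      using S.comp_ident(1)[of "Ident S []"]
      by (simp add: copy_strictification_Nil strictification_data_simps
          del: ident_strictification copy_strictification)
  qed
qed

end

section \<open>Composition and inversion of ICD-functors and ICD-natural transformations\<close>

context strong_symmetric_monoidal_functor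
begin

lemma farr_arr [simp]:
  assumes "f \<in> Arr C"
  shows "Farr F f \<in> Arr D" "Dom D (Farr F f) = Fobj F (Dom C f)" "Cod D (Farr F f) = Fobj F (Cod C f)"
  using farr[of f "Dom C f" "Cod C f"] assms by (simp_all add: Hom_iff)

lemmas farr_simps [simp] = fobj farr_ident fmult_iso funit_iso

lemma farr_comp_arr [simp]:
  "\<lbrakk>f \<in> Arr C; g \<in> Arr C; Dom C g = Cod C f\<rbrakk> \<Longrightarrow> Farr F (g \<cdot>\<^bsub>C\<^esub> f) = Farr F g \<cdot>\<^bsub>D\<^esub> Farr F f"
  using farr_comp by (auto simp: Hom_iff)

lemma fmult_arr [simp]:
  assumes "A \<in> Obj C" "B \<in> Obj C"
  shows "Fmult F A B \<in> Arr D" "Dom D (Fmult F A B) = Fobj F A \<odot>\<^bsub>D\<^esub> Fobj F B"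
    "Cod D (Fmult F A B) = Fobj F (A \<odot>\<^bsub>C\<^esub> B)"
  using fmult_hom[OF assms] by (simp_all add: Hom_iff)

lemma funit_arr [simp]:
  "Funit F \<in> Arr D" "Dom D (Funit F) = \<I>\<^bsub>D\<^esub>" "Cod D (Funit F) = Fobj F \<I>\<^bsub>C\<^esub>"
  using funit_hom by (simp_all add: Hom_iff)

lemma farr_iso [simp]:
  assumes "is_iso C f"
  shows "is_iso D (Farr F f)"
proof (rule D.is_isoI)
  note [simp] = C.iso_arr[OF assms]
  show "Farr F (inverse_of C f) \<cdot>\<^bsub>D\<^esub> Farr F f = id\<^bsub>D\<^esub> (Dom D (Farr F f))"
    using assms farr_comp_arr[of f "inverse_of C f"] by simp
  show "Farr F f \<cdot>\<^bsub>D\<^esub> Farr F (inverse_of C f) = id\<^bsub>D\<^esub> (Cod D (Farr F f))"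
    using assms farr_comp_arr[of "inverse_of C f" f] by simp
qed (use assms C.iso_arr[OF assms] in simp_all)

lemma fmult_natural_arr:
  assumes "f \<in> Arr C" "g \<in> Arr C" "Cod C f = A" "Cod C g = B"
  shows "Fmult F A B \<cdot>\<^bsub>D\<^esub> (Farr F f \<otimes>\<^bsub>D\<^esub> Farr F g) = Farr F (f \<otimes>\<^bsub>C\<^esub> g) \<cdot>\<^bsub>D\<^esub> Fmult F (Dom C f) (Dom C g)"
    "k \<in> Arr D \<Longrightarrow> Cod D k = Fobj F (Dom C f) \<odot>\<^bsub>D\<^esub> Fobj F (Dom C g) \<Longrightarrow>
      Fmult F A B \<cdot>\<^bsub>D\<^esub> (Farr F f \<otimes>\<^bsub>D\<^esub> Farr F g) \<cdot>\<^bsub>D\<^esub> k =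
      Farr F (f \<otimes>\<^bsub>C\<^esub> g) \<cdot>\<^bsub>D\<^esub> Fmult F (Dom C f) (Dom C g) \<cdot>\<^bsub>D\<^esub> k"
proof -
  have [simp]: "A \<in> Obj C" "B \<in> Obj C"
    using assms by auto
  show *: "Fmult F A B \<cdot>\<^bsub>D\<^esub> (Farr F f \<otimes>\<^bsub>D\<^esub> Farr F g) = Farr F (f \<otimes>\<^bsub>C\<^esub> g) \<cdot>\<^bsub>D\<^esub> Fmult F (Dom C f) (Dom C g)"
    using fmult_natural assms by (auto simp: Hom_iff)
  show "Fmult F A B \<cdot>\<^bsub>D\<^esub> (Farr F f \<otimes>\<^bsub>D\<^esub> Farr F g) \<cdot>\<^bsub>D\<^esub> k =
      Farr F (f \<otimes>\<^bsub>C\<^esub> g) \<cdot>\<^bsub>D\<^esub> Fmult F (Dom C f) (Dom C g) \<cdot>\<^bsub>D\<^esub> k"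
    if "k \<in> Arr D" "Cod D k = Fobj F (Dom C f) \<odot>\<^bsub>D\<^esub> Fobj F (Dom C g)"
    using that assms * by (simp flip: D.comp_assoc_arr)
qed

end

lemma comp_functor_simps [simp]:
  "Fobj (comp_functor E G F) A = Fobj G (Fobj F A)"
  "Farr (comp_functor E G F) f = Farr G (Farr F f)"
  "Fmult (comp_functor E G F) A B = Farr G (Fmult F A B) \<cdot>\<^bsub>E\<^esub> Fmult G (Fobj F A) (Fobj F B)"
  "Funit (comp_functor E G F) = Farr G (Funit F) \<cdot>\<^bsub>E\<^esub> Funit G"
  by (simp_all add: comp_functor_def)

lemma id_functor_simps [simp]:
  "Fobj (id_functor C) A = A" "Farr (id_functor C) f = f"
  "Fmult (id_functor C) A B = id\<^bsub>C\<^esub> (A \<odot>\<^bsub>C\<^esub> B)" "Funit (id_functor C) = id\<^bsub>C\<^esub> \<I>\<^bsub>C\<^esub>"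
  by (simp_all add: id_functor_def)

text \<open>For the coherence laws, the structure maps of \<open>G\<close> are moved to the right by naturality, so that the law for \<open>F\<close> applies
  under \<open>G\<close> to what is left, and the law for \<open>G\<close> to what has been moved.\<close>

lemma strong_icd_functor_comp:
  assumes "strong_icd_functor C D F" "strong_icd_functor D E G"
  shows "strong_icd_functor C E (comp_functor E G F)"
proof -
  interpret F: strong_icd_functor C D F
    by fact
  interpret G: strong_icd_functor D E G
    by fact
  show ?thesis
  proof unfold_locales
    fix A B X assume [simp]: "A \<in> Obj C" "B \<in> Obj C" "X \<in> Obj C"
    let ?H = "comp_functor E G F"
    let ?FA = "Fobj F A" and ?FB = "Fobj F B" and ?FX = "Fobj F X"
    let ?GA = "Fobj G ?FA" and ?GB = "Fobj G ?FB" and ?GX = "Fobj G ?FX"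
    \<comment> \<open>Composites under a tensor are to be split here, whereas the interchange law as a rewrite rule would merge
      them.\<close>
    note [simp del] = F.C.interchange F.D.interchange G.D.interchange
    have split_left: "(g \<cdot>\<^bsub>E\<^esub> f) \<otimes>\<^bsub>E\<^esub> id\<^bsub>E\<^esub> Z = (g \<otimes>\<^bsub>E\<^esub> id\<^bsub>E\<^esub> Z) \<cdot>\<^bsub>E\<^esub> (f \<otimes>\<^bsub>E\<^esub> id\<^bsub>E\<^esub> Z)"
      and split_right: "id\<^bsub>E\<^esub> Z \<otimes>\<^bsub>E\<^esub> (g \<cdot>\<^bsub>E\<^esub> f) = (id\<^bsub>E\<^esub> Z \<otimes>\<^bsub>E\<^esub> g) \<cdot>\<^bsub>E\<^esub> (id\<^bsub>E\<^esub> Z \<otimes>\<^bsub>E\<^esub> f)"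
      if "f \<in> Arr E" "g \<in> Arr E" "Dom E g = Cod E f" "Z \<in> Obj E" for f g Z
      using that by (simp_all add: G.D.interchange)
    have natural_left: "Fmult G Y Z \<cdot>\<^bsub>E\<^esub> (Farr G f \<otimes>\<^bsub>E\<^esub> id\<^bsub>E\<^esub> (Fobj G Z)) \<cdot>\<^bsub>E\<^esub> k =
        Farr G (f \<otimes>\<^bsub>D\<^esub> id\<^bsub>D\<^esub> Z) \<cdot>\<^bsub>E\<^esub> Fmult G (Dom D f) Z \<cdot>\<^bsub>E\<^esub> k"
      if "f \<in> Arr D" "Cod D f = Y" "Z \<in> Obj D" "k \<in> Arr E"
        "Cod E k = Fobj G (Dom D f) \<odot>\<^bsub>E\<^esub> Fobj G Z" for f Y Z k
      using that G.fmult_natural_arr(2)[of f "id\<^bsub>D\<^esub> Z" Y Z k] by simp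
    have natural_right: "Fmult G Z Y \<cdot>\<^bsub>E\<^esub> (id\<^bsub>E\<^esub> (Fobj G Z) \<otimes>\<^bsub>E\<^esub> Farr G f) \<cdot>\<^bsub>E\<^esub> k =
        Farr G (id\<^bsub>D\<^esub> Z \<otimes>\<^bsub>D\<^esub> f) \<cdot>\<^bsub>E\<^esub> Fmult G Z (Dom D f) \<cdot>\<^bsub>E\<^esub> k"
      if "f \<in> Arr D" "Cod D f = Y" "Z \<in> Obj D" "k \<in> Arr E"
        "Cod E k = Fobj G Z \<odot>\<^bsub>E\<^esub> Fobj G (Dom D f)" for f Y Z k
      using that G.fmult_natural_arr(2)[of "id\<^bsub>D\<^esub> Z" f Z Y k] by simp
    have farr_comp3: "Farr G f \<cdot>\<^bsub>E\<^esub> Farr G g \<cdot>\<^bsub>E\<^esub> Farr G h \<cdot>\<^bsub>E\<^esub> k = Farr G (f \<cdot>\<^bsub>D\<^esub> g \<cdot>\<^bsub>D\<^esub> h) \<cdot>\<^bsub>E\<^esub> k"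
      if "f \<in> Arr D" "g \<in> Arr D" "h \<in> Arr D" "Dom D g = Cod D h" "Dom D f = Cod D g"
         "k \<in> Arr E" "Cod E k = Fobj G (Dom D h)" for f g h k
      using that by (simp add: G.D.comp_assoc_arr)
    have "Farr ?H (\<a>\<^bsub>C\<^esub> A B X) \<cdot>\<^bsub>E\<^esub> Fmult ?H (A \<odot>\<^bsub>C\<^esub> B) X \<cdot>\<^bsub>E\<^esub> (Fmult ?H A B \<otimes>\<^bsub>E\<^esub> id\<^bsub>E\<^esub> ?GX) =
        Farr G (Farr F (\<a>\<^bsub>C\<^esub> A B X)) \<cdot>\<^bsub>E\<^esub> Farr G (Fmult F (A \<odot>\<^bsub>C\<^esub> B) X) \<cdot>\<^bsub>E\<^esub>
        Farr G (Fmult F A B \<otimes>\<^bsub>D\<^esub> id\<^bsub>D\<^esub> ?FX) \<cdot>\<^bsub>E\<^esub> Fmult G (?FA \<odot>\<^bsub>D\<^esub> ?FB) ?FX \<cdot>\<^bsub>E\<^esub>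
        (Fmult G ?FA ?FB \<otimes>\<^bsub>E\<^esub> id\<^bsub>E\<^esub> ?GX)"
      by (simp add: G.D.comp_assoc_arr split_left natural_left)
    also have "\<dots> = Farr G (Fmult F A (B \<odot>\<^bsub>C\<^esub> X) \<cdot>\<^bsub>D\<^esub> (id\<^bsub>D\<^esub> ?FA \<otimes>\<^bsub>D\<^esub> Fmult F B X) \<cdot>\<^bsub>D\<^esub> \<a>\<^bsub>D\<^esub> ?FA ?FB ?FX) \<cdot>\<^bsub>E\<^esub>
        Fmult G (?FA \<odot>\<^bsub>D\<^esub> ?FB) ?FX \<cdot>\<^bsub>E\<^esub> (Fmult G ?FA ?FB \<otimes>\<^bsub>E\<^esub> id\<^bsub>E\<^esub> ?GX)"
      by (subst farr_comp3) (simp_all add: F.fmult_assoc)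
    also have "\<dots> = Farr G (Fmult F A (B \<odot>\<^bsub>C\<^esub> X)) \<cdot>\<^bsub>E\<^esub> Farr G (id\<^bsub>D\<^esub> ?FA \<otimes>\<^bsub>D\<^esub> Fmult F B X) \<cdot>\<^bsub>E\<^esub>
        Fmult G ?FA (?FB \<odot>\<^bsub>D\<^esub> ?FX) \<cdot>\<^bsub>E\<^esub> (id\<^bsub>E\<^esub> ?GA \<otimes>\<^bsub>E\<^esub> Fmult G ?FB ?FX) \<cdot>\<^bsub>E\<^esub> \<a>\<^bsub>E\<^esub> ?GA ?GB ?GX"
      by (simp add: G.D.comp_assoc_arr G.fmult_assoc)
    also have "\<dots> = Fmult ?H A (B \<odot>\<^bsub>C\<^esub> X) \<cdot>\<^bsub>E\<^esub> (id\<^bsub>E\<^esub> ?GA \<otimes>\<^bsub>E\<^esub> Fmult ?H B X) \<cdot>\<^bsub>E\<^esub> \<a>\<^bsub>E\<^esub> ?GA ?GB ?GX"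
      by (simp add: G.D.comp_assoc_arr split_right natural_right)
    finally show "Farr ?H (\<a>\<^bsub>C\<^esub> A B X) \<cdot>\<^bsub>E\<^esub> Fmult ?H (A \<odot>\<^bsub>C\<^esub> B) X \<cdot>\<^bsub>E\<^esub> (Fmult ?H A B \<otimes>\<^bsub>E\<^esub> id\<^bsub>E\<^esub> (Fobj ?H X)) =
        Fmult ?H A (B \<odot>\<^bsub>C\<^esub> X) \<cdot>\<^bsub>E\<^esub> (id\<^bsub>E\<^esub> (Fobj ?H A) \<otimes>\<^bsub>E\<^esub> Fmult ?H B X) \<cdot>\<^bsub>E\<^esub>
        \<a>\<^bsub>E\<^esub> (Fobj ?H A) (Fobj ?H B) (Fobj ?H X)"
      by simp
    have "Farr ?H (\<l>\<^bsub>C\<^esub> A) \<cdot>\<^bsub>E\<^esub> Fmult ?H \<I>\<^bsub>C\<^esub> A \<cdot>\<^bsub>E\<^esub> (Funit ?H \<otimes>\<^bsub>E\<^esub> id\<^bsub>E\<^esub> ?GA) =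
        Farr G (Farr F (\<l>\<^bsub>C\<^esub> A)) \<cdot>\<^bsub>E\<^esub> Farr G (Fmult F \<I>\<^bsub>C\<^esub> A) \<cdot>\<^bsub>E\<^esub> Farr G (Funit F \<otimes>\<^bsub>D\<^esub> id\<^bsub>D\<^esub> ?FA)
        \<cdot>\<^bsub>E\<^esub> Fmult G \<I>\<^bsub>D\<^esub> ?FA \<cdot>\<^bsub>E\<^esub> (Funit G \<otimes>\<^bsub>E\<^esub> id\<^bsub>E\<^esub> ?GA)"
      by (simp add: G.D.comp_assoc_arr split_left natural_left)
    also have "\<dots> = \<l>\<^bsub>E\<^esub> ?GA"
      by (subst farr_comp3) (simp_all add: F.fmult_unit_left G.fmult_unit_left)
    finally show "Farr ?H (\<l>\<^bsub>C\<^esub> A) \<cdot>\<^bsub>E\<^esub> Fmult ?H \<I>\<^bsub>C\<^esub> A \<cdot>\<^bsub>E\<^esub> (Funit ?H \<otimes>\<^bsub>E\<^esub> id\<^bsub>E\<^esub> (Fobj ?H A)) = \<l>\<^bsub>E\<^esub> (Fobj ?H A)"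
      by simp
    have "Farr ?H (\<r>\<^bsub>C\<^esub> A) \<cdot>\<^bsub>E\<^esub> Fmult ?H A \<I>\<^bsub>C\<^esub> \<cdot>\<^bsub>E\<^esub> (id\<^bsub>E\<^esub> ?GA \<otimes>\<^bsub>E\<^esub> Funit ?H) =
        Farr G (Farr F (\<r>\<^bsub>C\<^esub> A)) \<cdot>\<^bsub>E\<^esub> Farr G (Fmult F A \<I>\<^bsub>C\<^esub>) \<cdot>\<^bsub>E\<^esub> Farr G (id\<^bsub>D\<^esub> ?FA \<otimes>\<^bsub>D\<^esub> Funit F)
        \<cdot>\<^bsub>E\<^esub> Fmult G ?FA \<I>\<^bsub>D\<^esub> \<cdot>\<^bsub>E\<^esub> (id\<^bsub>E\<^esub> ?GA \<otimes>\<^bsub>E\<^esub> Funit G)"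
      by (simp add: G.D.comp_assoc_arr split_right natural_right)
    also have "\<dots> = \<r>\<^bsub>E\<^esub> ?GA"
      by (subst farr_comp3) (simp_all add: F.fmult_unit_right G.fmult_unit_right)
    finally show "Farr ?H (\<r>\<^bsub>C\<^esub> A) \<cdot>\<^bsub>E\<^esub> Fmult ?H A \<I>\<^bsub>C\<^esub> \<cdot>\<^bsub>E\<^esub> (id\<^bsub>E\<^esub> (Fobj ?H A) \<otimes>\<^bsub>E\<^esub> Funit ?H) = \<r>\<^bsub>E\<^esub> (Fobj ?H A)"
      by simp
  next
    fix A B assume [simp]: "A \<in> Obj C" "B \<in> Obj C"
    let ?H = "comp_functor E G F"
    let ?FA = "Fobj F A" and ?FB = "Fobj F B"
    show "Fmult ?H A B \<in> Hom E (Fobj ?H A \<odot>\<^bsub>E\<^esub> Fobj ?H B) (Fobj ?H (A \<odot>\<^bsub>C\<^esub> B))" "is_iso E (Fmult ?H A B)"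
      by (simp_all add: Hom_iff)
    show "self_adjoint E (Fmult ?H A B)"
      using F.fmult_self_adjoint[of A B] G.fmult_self_adjoint[of ?FA ?FB] G.farr_conj[of "Fmult F A B"]
      by (simp add: self_adjoint_def)
    have "Farr G (Farr F (swap\<^bsub>C\<^esub> A B)) \<cdot>\<^bsub>E\<^esub> Farr G (Fmult F A B) = Farr G (Fmult F B A) \<cdot>\<^bsub>E\<^esub> Farr G (swap\<^bsub>D\<^esub> ?FA ?FB)"
      using F.fmult_swap[of A B] by (simp flip: G.farr_comp_arr)
    then show "Farr ?H (swap\<^bsub>C\<^esub> A B) \<cdot>\<^bsub>E\<^esub> Fmult ?H A B = Fmult ?H B A \<cdot>\<^bsub>E\<^esub> swap\<^bsub>E\<^esub> (Fobj ?H A) (Fobj ?H B)"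
      using G.fmult_swap[of ?FA ?FB]
        G.D.comp_assoc_arr[of "Fmult G ?FA ?FB" "Farr G (Fmult F A B)" "Farr G (Farr F (swap\<^bsub>C\<^esub> A B))"]
      by (simp add: G.D.comp_assoc_arr)
  next
    fix f g A B A' B' assume "f \<in> Hom C A A'" "g \<in> Hom C B B'"
    then have [simp]: "f \<in> Arr C" "g \<in> Arr C" "A \<in> Obj C" "B \<in> Obj C" "A' \<in> Obj C" "B' \<in> Obj C"
      and [simp]: "Dom C f = A" "Cod C f = A'" "Dom C g = B" "Cod C g = B'"
      by (auto simp: Hom_iff)
    let ?H = "comp_functor E G F"
    have "Farr G (Fmult F A' B') \<cdot>\<^bsub>E\<^esub> Farr G (Farr F f \<otimes>\<^bsub>D\<^esub> Farr F g) =
        Farr G (Farr F (f \<otimes>\<^bsub>C\<^esub> g)) \<cdot>\<^bsub>E\<^esub> Farr G (Fmult F A B)"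
      using F.fmult_natural_arr(1)[of f g] by (simp flip: G.farr_comp_arr)
    then show "Fmult ?H A' B' \<cdot>\<^bsub>E\<^esub> (Farr ?H f \<otimes>\<^bsub>E\<^esub> Farr ?H g) = Farr ?H (f \<otimes>\<^bsub>C\<^esub> g) \<cdot>\<^bsub>E\<^esub> Fmult ?H A B"
      by (simp add: G.D.comp_assoc_arr G.fmult_natural_arr) (simp flip: G.D.comp_assoc_arr)
  next
    fix A assume [simp]: "A \<in> Obj C"
    let ?H = "comp_functor E G F"
    show "Fmult ?H A A \<cdot>\<^bsub>E\<^esub> copy\<^bsub>E\<^esub> (Fobj ?H A) = Farr ?H (copy\<^bsub>C\<^esub> A)"
      by (simp add: G.D.comp_assoc_arr G.fmult_copy flip: F.fmult_copy)
    show "Funit ?H \<cdot>\<^bsub>E\<^esub> del\<^bsub>E\<^esub> (Fobj ?H A) = Farr ?H (del\<^bsub>C\<^esub> A)"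
      by (simp add: G.D.comp_assoc_arr G.funit_del flip: F.funit_del)
  next
    show "self_adjoint E (Funit (comp_functor E G F))"
      using F.funit_self_adjoint G.funit_self_adjoint G.farr_conj[of "Funit F"]
      by (simp add: self_adjoint_def)
  qed (auto simp: Hom_iff F.farr_conj G.farr_conj)
qed

lemma (in icd_category) strong_icd_functor_id: "strong_icd_functor C C (id_functor C)"
  by unfold_locales (auto simp: Hom_iff self_adjoint_def)

lemma (in icd_category) deterministic_ident: "A \<in> Obj C \<Longrightarrow> deterministic C (id A)"
  by (simp add: deterministic_def self_adjoint_def total_arr_def)

text \<open>Each equation is checked after composition with \<open>f\<close>, where it becomes the corresponding equation for \<open>f\<close>.\<close>

lemma (in icd_category) deterministic_inverse_of:
  assumes "is_iso C f" "deterministic C f"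
  shows "deterministic C (inverse_of C f)"
proof -
  note [simp] = assms(1) iso_arr[OF assms(1)]
  have f: "conj f = f" "del (Cod C f) \<cdot> f = del (Dom C f)" "copy (Cod C f) \<cdot> f = (f \<otimes> f) \<cdot> copy (Dom C f)"
    using assms(2) by (auto simp: deterministic_def self_adjoint_def total_arr_def)
  let ?g = "inverse_of C f"
  have "(del (Dom C f) \<cdot> ?g) \<cdot> f = del (Cod C f) \<cdot> f"
    by (simp add: comp_assoc_arr f)
  then have "del (Dom C f) \<cdot> ?g = del (Cod C f)"
    by (rule iso_cancel_right[rotated]) auto
  moreover have "(copy (Dom C f) \<cdot> ?g) \<cdot> f = ((?g \<otimes> ?g) \<cdot> copy (Cod C f)) \<cdot> f"
    by (simp add: comp_assoc_arr f)
  then have "copy (Dom C f) \<cdot> ?g = (?g \<otimes> ?g) \<cdot> copy (Cod C f)"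
    by (rule iso_cancel_right[rotated]) auto
  ultimately show ?thesis
    using f(1) by (simp add: deterministic_def self_adjoint_def total_arr_def conj_inverse_of)
qed

text \<open>The pointwise inverses automatically form an ICD-natural transformation: every condition on them, composed with the
  components of \<open>\<eta>\<close>, is the matching condition on \<open>\<eta>\<close>.\<close>

lemma icd_natural_isomorphismI:
  assumes "icd_natural_transformation C D F G \<eta>" and iso: "\<And>A. A \<in> Obj C \<Longrightarrow> is_iso D (\<eta> A)"
  shows "icd_natural_isomorphism C D F G \<eta>"
proof -
  interpret icd_natural_transformation C D F G \<eta>
    by fact
  have [simp]: "\<eta> A \<in> Arr D" "Dom D (\<eta> A) = Fobj F A" "Cod D (\<eta> A) = Fobj G A" if "A \<in> Obj C" for A
    using component_hom[OF that] by (simp_all add: Hom_iff)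
  note [simp] = iso
  let ?\<theta> = "\<lambda>A. inverse_of D (\<eta> A)"
  have "icd_natural_transformation C D G F ?\<theta>"
  proof unfold_locales
    fix f A B assume f: "f \<in> Hom C A B"
    then have [simp]: "f \<in> Arr C" "A \<in> Obj C" "B \<in> Obj C" "Dom C f = A" "Cod C f = B"
      by (auto simp: Hom_iff)
    have "(?\<theta> B \<cdot>\<^bsub>D\<^esub> Farr G f) \<cdot>\<^bsub>D\<^esub> \<eta> A = (Farr F f \<cdot>\<^bsub>D\<^esub> ?\<theta> A) \<cdot>\<^bsub>D\<^esub> \<eta> A"
      by (simp add: F.D.comp_assoc_arr flip: natural[OF f])
    then show "?\<theta> B \<cdot>\<^bsub>D\<^esub> Farr G f = Farr F f \<cdot>\<^bsub>D\<^esub> ?\<theta> A"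
      by (rule F.D.iso_cancel_right[rotated]) auto
  next
    fix A B assume [simp]: "A \<in> Obj C" "B \<in> Obj C"
    have "(?\<theta> (A \<odot>\<^bsub>C\<^esub> B) \<cdot>\<^bsub>D\<^esub> Fmult G A B) \<cdot>\<^bsub>D\<^esub> (\<eta> A \<otimes>\<^bsub>D\<^esub> \<eta> B) =
        (Fmult F A B \<cdot>\<^bsub>D\<^esub> (?\<theta> A \<otimes>\<^bsub>D\<^esub> ?\<theta> B)) \<cdot>\<^bsub>D\<^esub> (\<eta> A \<otimes>\<^bsub>D\<^esub> \<eta> B)"
      by (simp add: F.D.comp_assoc_arr flip: component_tensor)
    then show "?\<theta> (A \<odot>\<^bsub>C\<^esub> B) \<cdot>\<^bsub>D\<^esub> Fmult G A B = Fmult F A B \<cdot>\<^bsub>D\<^esub> (?\<theta> A \<otimes>\<^bsub>D\<^esub> ?\<theta> B)"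
      by (rule F.D.iso_cancel_right[rotated]) auto
  next
    show "?\<theta> \<I>\<^bsub>C\<^esub> \<cdot>\<^bsub>D\<^esub> Funit G = Funit F"
      by (simp flip: component_unit)
  qed (simp_all add: Hom_iff F.D.deterministic_inverse_of component_deterministic)
  moreover have "inverse_arrows D (\<eta> A) (?\<theta> A)" if "A \<in> Obj C" for A
    using that by (simp add: F.D.inverse_arrows_inverse_of)
  ultimately show ?thesis
    unfolding icd_natural_isomorphism_def using assms(1) by blast
qed

section \<open>The equivalence\<close>

text \<open>The coherence data of evaluation are the arrows \<open>\<mu>\<close> themselves. Those of \<open>A \<mapsto> [A]\<close> are the arrows from
  \<open>[A, B]\<close> to \<open>[A \<odot> B]\<close> and from \<open>[]\<close> to \<open>[\<I>]\<close> with an identity in the middle, since both lists have the same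
  value.\<close>

definition strictification_functor ::
  "('o, 'a, 'z) icd_category_scheme \<Rightarrow> ('o list, 'o list \<times> 'a \<times> 'o list, 'o, 'a) monoidal_functor_data" where
  "strictification_functor C =
     \<lparr>Fobj = tensor_list C, Farr = underlying, Fmult = merge C, Funit = id\<^bsub>C\<^esub> \<I>\<^bsub>C\<^esub>\<rparr>"

definition singleton_functor ::
  "('o, 'a, 'z) icd_category_scheme \<Rightarrow> ('o, 'a, 'o list, 'o list \<times> 'a \<times> 'o list) monoidal_functor_data" where
  "singleton_functor C =
     \<lparr>Fobj = (\<lambda>A. [A]), Farr = (\<lambda>f. ([Dom C f], f, [Cod C f])),
      Fmult = (\<lambda>A B. ([A, B], id\<^bsub>C\<^esub> (A \<odot>\<^bsub>C\<^esub> B), [A \<odot>\<^bsub>C\<^esub> B])),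
      Funit = ([], id\<^bsub>C\<^esub> \<I>\<^bsub>C\<^esub>, [\<I>\<^bsub>C\<^esub>])\<rparr>"

context icd_category
begin

lemma is_iso_strictification:
  assumes "f \<in> Arr S" "is_iso C (underlying f)"
  shows "is_iso S f"
proof -
  interpret S: icd_category S
    by (rule icd_strictification)
  let ?g = "(Cod S f, inverse_of C (underlying f), Dom S f)"
  show ?thesis
  proof (rule S.is_isoI)
    show "f \<in> Arr S"
      by fact
    show "?g \<in> Arr S"
      using assms by (intro strictification_arrI) simp_all
    show "Comp S ?g f = Ident S (Dom S f)" "Comp S f ?g = Ident S (Cod S f)"
      using assms by (auto intro: strictification_arr_eqI)
  qed simp_all
qed

lemma strictification_functor_simps [simp]:
  "Fobj (strictification_functor C) v = \<Otimes> v" "Farr (strictification_functor C) f = underlying f"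
  "Fmult (strictification_functor C) v w = \<mu> v w" "Funit (strictification_functor C) = id \<I>"
  by (simp_all add: strictification_functor_def)

lemma singleton_functor_simps [simp]:
  "Fobj (singleton_functor C) A = [A]" "Farr (singleton_functor C) x = ([Dom C x], x, [Cod C x])"
  "Fmult (singleton_functor C) A B = ([A, B], id (A \<odot> B), [A \<odot> B])"
  "Funit (singleton_functor C) = ([], id \<I>, [\<I>])"
  by (simp_all add: singleton_functor_def)

lemma strong_icd_strictification_functor: "strong_icd_functor S C (strictification_functor C)"
proof -
  interpret S: icd_category S
    by (rule icd_strictification)
  show ?thesis
    by unfold_locales (auto simp: Hom_iff self_adjoint_def merge_assoc comp_assoc_arr)
qed

lemma strong_icd_singleton_functor: "strong_icd_functor C S (singleton_functor C)"
proof -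
  interpret S: icd_category S
    by (rule icd_strictification)
  show ?thesis
    by unfold_locales
      (auto simp: Hom_iff self_adjoint_def comp_assoc_arr
        intro!: strictification_arr_eqI is_iso_strictification strictification_arrI)
qed

text \<open>Evaluation after \<open>A \<mapsto> [A]\<close> leaves objects and arrows unchanged, and its coherence data reduce to identities.\<close>

lemma counit_isomorphism:
  "icd_natural_isomorphism C C (comp_functor C (strictification_functor C) (singleton_functor C))
     (id_functor C) (Ident C)"
proof (rule icd_natural_isomorphismI)
  interpret FG: strong_icd_functor C C "comp_functor C (strictification_functor C) (singleton_functor C)"
    by (rule strong_icd_functor_comp[OF strong_icd_singleton_functor strong_icd_strictification_functor])
  interpret I: strong_icd_functor C C "id_functor C"
    by (rule strong_icd_functor_id)
  show "icd_natural_transformation C C (comp_functor C (strictification_functor C) (singleton_functor C))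
     (id_functor C) (Ident C)"
    by unfold_locales (auto simp: Hom_iff deterministic_ident left_unitor_unit)
qed simp

text \<open>The lists \<open>[\<Otimes> v]\<close> and \<open>v\<close> have the same value. The identity of that value is an arrow between them, and each condition
  on it reduces to an equation in \<open>C\<close> between \<open>\<mu>\<close>'s or copies composed with identities.\<close>

lemma unit_isomorphism:
  "icd_natural_isomorphism S S (comp_functor S (singleton_functor C) (strictification_functor C))
     (id_functor S) (\<lambda>v. ([\<Otimes> v], id (\<Otimes> v), v))"
proof (rule icd_natural_isomorphismI)
  let ?GF = "comp_functor S (singleton_functor C) (strictification_functor C)"
  let ?\<eta> = "\<lambda>v. ([\<Otimes> v], id (\<Otimes> v), v)"
  interpret S: icd_category S
    by (rule icd_strictification)
  interpret GF: strong_icd_functor S S ?GF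
    by (rule strong_icd_functor_comp[OF strong_icd_strictification_functor strong_icd_singleton_functor])
  interpret I: strong_icd_functor S S "id_functor S"
    by (rule S.strong_icd_functor_id)
  have arr: "?\<eta> v \<in> Arr S" if "v \<in> words" for v
    using that by (intro strictification_arrI) simp_all
  then show "is_iso S (?\<eta> v)" if "v \<in> Obj S" for v
    using that by (intro is_iso_strictification) simp_all
  show "icd_natural_transformation S S ?GF (id_functor S) ?\<eta>"
  proof unfold_locales
    fix v assume "v \<in> Obj S"
    then have v: "v \<in> words"
      by simp
    then show "?\<eta> v \<in> Hom S (Fobj ?GF v) (Fobj (id_functor S) v)"
      by (simp add: Hom_iff arr)
    show "deterministic S (?\<eta> v)"
      unfolding deterministic_def self_adjoint_def total_arr_def
      by (intro conjI strictification_arr_eqI) (simp_all add: v)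
  next
    fix f v w assume "f \<in> Hom S v w"
    then show "Comp S (?\<eta> w) (Farr ?GF f) = Comp S (Farr (id_functor S) f) (?\<eta> v)"
      by (auto simp: Hom_iff intro!: strictification_arr_eqI)
  next
    fix v w assume "v \<in> Obj S" "w \<in> Obj S"
    then show "Comp S (?\<eta> (Tensor_obj S v w)) (Fmult ?GF v w) =
        Comp S (Fmult (id_functor S) v w) (Tensor_arr S (?\<eta> v) (?\<eta> w))"
      by (intro strictification_arr_eqI) simp_all
  next
    show "Comp S (?\<eta> (Unit_obj S)) (Funit ?GF) = Funit (id_functor S)"
      by (rule strictification_arr_eqI) simp_all
  qed
qed

end

theorem theorem2p44:
  fixes C :: "('o, 'a) icd_category"
  assumes "icd_category C"
  shows "\<exists>(C' :: ('o list, 'o list \<times> 'a \<times> 'o list) icd_category) F.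
           icd_category C' \<and> strict_monoidal_category C' \<and> icd_equivalence C' C F"
proof -
  interpret icd_category C
    by fact
  have "icd_equivalence S C (strictification_functor C)"
    unfolding icd_equivalence_def
    using strong_icd_strictification_functor strong_icd_singleton_functor
      counit_isomorphism unit_isomorphism by blast
  then show ?thesis
    using icd_strictification strict_monoidal_strictification by blast
qed

end
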